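(* Let $W$ be a negative definite $\mathrm{SU}(2)$ connection on $P\to M$, let $E_W$ be the unique (orientation-compatible) frame 1-form on $P$ with $F(W)=E_W\wedge E_W$, and let $\Omega=CS(W)$. Then the condition $d\hat\Omega=0$ is equivalent to $\nabla_WE_W=0$, i.e. to the statement that the connection $W$ is torsion-free.
   Context: Setting. $M$ is an oriented smooth 3-manifold and $P\to M$ is a principal $\mathrm{SU}(2)$ bundle (right action). The 6-manifold $P$ is oriented. $\mathfrak{su}(2)$ consists of tracefree anti-hermitian $2\times2$ matrices with basis $\tau_i=-\frac{\mathrm{i}}{2}\sigma_i$ ($\sigma_i$ the Pauli matrices). Products of matrix-valued forms combine matrix product and wedge product. A connection is an $\mathfrak{su}(2)$-valued 1-form $W$ on $P$ (in a trivialisation $W=g^{-1}\mathbf{w}g+g^{-1}dg$), with curvature $F(W)=dW+W\wedge W$. Frames. A frame 1-form is a horizontal $\mathfrak{su}(2)$-valued 1-form $E=E^i\tau_i$ on $P$ with $R_g^*E=g^{-1}Eg$ and with $E^1,E^2,E^3$ pointwise linearly independent. It is compatible with the orientation of $M$ if the 3-form $-\frac23\mathrm{Tr}(E\wedge E\wedge E)$, which descends to $M$, is positive. The covariant exterior derivative is $\nabla_WE=dE+W\wedge E+E\wedge W$. Chern-Simons form. $CS(W)=\mathrm{Tr}\left(W\wedge dW+\frac23W\wedge W\wedge W\right)$, a 3-form on $P$ (it is closed because $M$ is 3-dimensional). Stable 3-forms in 6D. For a real 3-form $\Omega$ on $P$ and a positive volume form $v$, define $K_\Omega:T^*P\to T^*P$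 by $i_\xi(K_\Omega(\alpha))=\alpha\wedge i_\xi\Omega\wedge\Omega/v$ for all tangent vectors $\xi$. Then $K_\Omega^2=\lambda(\Omega)\,\mathbb{I}$ with $\lambda(\Omega)=\frac16\mathrm{Tr}(K_\Omega^2)$. $\Omega$ is stable of negative type if $\lambda(\Omega)<0$ everywhere; then $J_\Omega=K_\Omega/\sqrt{-\lambda(\Omega)}$ is an almost-complex structure on $P$, and $\hat\Omega:=-J_\Omega(\Omega)$, where $J_\Omega$ acts on all three form indices of $\Omega$. $W$ is called negative definite if $CS(W)$ is stable of negative type. *)

theory Defs
  imports "HOL-Analysis.Analysis" "HOL-Combinatorics.Permutations"
begin

section \<open>Smooth functions on Euclidean spaces\<close>

primrec cont_diff_on ::
  "nat \<Rightarrow> 'a::euclidean_space set \<Rightarrow> ('a \<Rightarrow> 'b::real_normed_vector) \<Rightarrow> bool" where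
  "cont_diff_on 0 S f = continuous_on S f"
| "cont_diff_on (Suc n) S f =
     ((\<forall>x\<in>S. f differentiable (at x)) \<and>
      (\<forall>u. cont_diff_on n S (\<lambda>x. frechet_derivative f (at x) u)))"

text \<open>To be used for open sets \<open>S\<close> only.\<close>

definition smooth_on_open ::
  "'a::euclidean_space set \<Rightarrow> ('a \<Rightarrow> 'b::real_normed_vector) \<Rightarrow> bool" where
  "smooth_on_open S f \<longleftrightarrow> (\<forall>n. cont_diff_on n S f)"

text \<open>Smoothness on an arbitrary subset: existence of local smooth extensions. It is used for maps
  defined on (open subset of \<open>\<real>^n\<close>) \<open>\<times>\<close> \<open>SU(2)\<close>, where \<open>SU(2)\<close> is regarded as an
  embedded submanifold of the space of complex \<open>2 \<times> 2\<close> matrices.\<close>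

definition smooth_on_subset ::
  "'a::euclidean_space set \<Rightarrow> ('a \<Rightarrow> 'b::real_normed_vector) \<Rightarrow> bool" where
  "smooth_on_subset S f \<longleftrightarrow>
     (\<forall>x\<in>S. \<exists>U f'. open U \<and> x \<in> U \<and> smooth_on_open U f' \<and> (\<forall>y\<in>S \<inter> U. f' y = f y))"


section \<open>Manifolds\<close>

text \<open>A chart is an open domain together with a coordinate map; the values of the coordinate map
  outside of the domain are irrelevant.\<close>

type_synonym ('a, 'n) chart = "'a set \<times> ('a \<Rightarrow> real ^ 'n)"

abbreviation chart_dom :: "('a, 'n::finite) chart \<Rightarrow> 'a set" where
  "chart_dom \<equiv> fst"

abbreviation chart_map :: "('a, 'n::finite) chart \<Rightarrow> 'a \<Rightarrow> real ^ 'n" where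
  "chart_map \<equiv> snd"

definition chart_img :: "('a, 'n::finite) chart \<Rightarrow> (real ^ 'n) set" where
  "chart_img c = chart_map c ` chart_dom c"

definition chart_inv :: "('a, 'n::finite) chart \<Rightarrow> real ^ 'n \<Rightarrow> 'a" where
  "chart_inv c = inv_into (chart_dom c) (chart_map c)"

definition is_chart :: "('a::topological_space, 'n::finite) chart \<Rightarrow> bool" where
  "is_chart c \<longleftrightarrow> open (chart_dom c) \<and> open (chart_img c) \<and>
     homeomorphism (chart_dom c) (chart_img c) (chart_map c) (chart_inv c)"

definition coord_rep ::
  "('a, 'n::finite) chart \<Rightarrow> ('b, 'k::finite) chart \<Rightarrow> ('a \<Rightarrow> 'b) \<Rightarrow> real ^ 'n \<Rightarrow> real ^ 'k" where
  "coord_rep c c' f = (\<lambda>x. chart_map c' (f (chart_inv c x)))"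

definition coord_diff ::
  "('a, 'n::finite) chart \<Rightarrow> ('b, 'k::finite) chart \<Rightarrow> ('a \<Rightarrow> 'b) \<Rightarrow> 'a \<Rightarrow> real ^ 'n \<Rightarrow> real ^ 'k" where
  "coord_diff c c' f p = frechet_derivative (coord_rep c c' f) (at (chart_map c p))"

text \<open>The whole type \<open>'a\<close> is the underlying set of the manifold; in the theorem it is of sort
  \<open>{t2_space, second_countable_topology}\<close>.\<close>

definition smooth_atlas :: "('a::topological_space, 'n::finite) chart set \<Rightarrow> bool" where
  "smooth_atlas A \<longleftrightarrow>
     (\<forall>c\<in>A. is_chart c) \<and> (\<Union>c\<in>A. chart_dom c) = UNIV \<and>
     (\<forall>c\<in>A. \<forall>c'\<in>A.
        smooth_on_open (chart_map c ` (chart_dom c \<inter> chart_dom c')) (coord_rep c c' id))"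

text \<open>An orientation is given by an atlas consisting of positively oriented charts.\<close>

definition oriented_atlas :: "('a::topological_space, 'n::finite) chart set \<Rightarrow> bool" where
  "oriented_atlas A \<longleftrightarrow> smooth_atlas A \<and>
     (\<forall>c\<in>A. \<forall>c'\<in>A. \<forall>p\<in>chart_dom c \<inter> chart_dom c'. det (matrix (coord_diff c c' id p)) > 0)"

definition smooth_map ::
  "('a::topological_space, 'n::finite) chart set \<Rightarrow> ('b::topological_space, 'k::finite) chart set \<Rightarrow>
   ('a \<Rightarrow> 'b) \<Rightarrow> bool" where
  "smooth_map A B f \<longleftrightarrow> continuous_on UNIV f \<and>
     (\<forall>c\<in>A. \<forall>c'\<in>B.
        smooth_on_open (chart_map c ` (chart_dom c \<inter> f -` chart_dom c')) (coord_rep c c' f))"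


section \<open>Differential forms\<close>

text \<open>The value of a \<open>k\<close>-form at a point, in coordinates, is a function of lists of \<open>k\<close> tangent
  vectors; its values on lists of other lengths are irrelevant.\<close>

definition alternating_multilinear ::
  "nat \<Rightarrow> ('v::real_vector list \<Rightarrow> 'b::real_vector) \<Rightarrow> bool" where
  "alternating_multilinear k \<omega> \<longleftrightarrow>
     (\<forall>us. length us = k \<longrightarrow>
        (\<forall>i<k. linear (\<lambda>u. \<omega> (us[i := u]))) \<and>
        (\<forall>i<k. \<forall>j<k. i \<noteq> j \<and> us ! i = us ! j \<longrightarrow> \<omega> us = 0))"

text \<open>A form on a manifold is the family of its local representatives: \<open>\<omega> c x us\<close> is its value at
  the point with coordinates \<open>x\<close> in the chart \<open>c\<close> on the tangent vectors whose components in
  the chart \<open>c\<close> are \<open>us\<close>.\<close>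

type_synonym ('a, 'n, 'b) form_field = "('a, 'n) chart \<Rightarrow> real ^ 'n \<Rightarrow> (real ^ 'n) list \<Rightarrow> 'b"

definition is_pullback ::
  "('a, 'n::finite) chart set \<Rightarrow> ('b, 'k::finite) chart set \<Rightarrow> ('a \<Rightarrow> 'b) \<Rightarrow> nat \<Rightarrow>
   ('b, 'k, 'c) form_field \<Rightarrow> ('a, 'n, 'c) form_field \<Rightarrow> bool" where
  "is_pullback A B f k \<eta> \<omega> \<longleftrightarrow>
     (\<forall>c\<in>A. \<forall>c'\<in>B. \<forall>p\<in>chart_dom c. f p \<in> chart_dom c' \<longrightarrow>
        (\<forall>us. length us = k \<longrightarrow>
           \<omega> c (chart_map c p) us = \<eta> c' (chart_map c' (f p)) (map (coord_diff c c' f p) us)))"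

text \<open>The last condition is the transformation law under changes of charts.\<close>

definition smooth_form ::
  "('a, 'n::finite) chart set \<Rightarrow> nat \<Rightarrow> ('a, 'n, 'b::real_normed_vector) form_field \<Rightarrow> bool" where
  "smooth_form A k \<omega> \<longleftrightarrow>
     (\<forall>c\<in>A. \<forall>x\<in>chart_img c. alternating_multilinear k (\<omega> c x)) \<and>
     (\<forall>c\<in>A. \<forall>us. length us = k \<longrightarrow> smooth_on_open (chart_img c) (\<lambda>x. \<omega> c x us)) \<and>
     is_pullback A A id k \<omega> \<omega>"

definition form_eq ::
  "('a, 'n::finite) chart set \<Rightarrow> nat \<Rightarrow> ('a, 'n, 'b) form_field \<Rightarrow> ('a, 'n, 'b) form_field \<Rightarrow> bool" where
  "form_eq A k \<omega> \<eta> \<longleftrightarrow>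
     (\<forall>c\<in>A. \<forall>x\<in>chart_img c. \<forall>us. length us = k \<longrightarrow> \<omega> c x us = \<eta> c x us)"

text \<open>Convention: \<open>(\<alpha> \<and> \<beta>)(u, w) = \<alpha>(u) \<beta>(w) - \<alpha>(w) \<beta>(u)\<close> for \<open>1\<close>-forms. The first argument
  is the (bilinear) product of the values.\<close>

definition wedge ::
  "('b \<Rightarrow> 'c \<Rightarrow> 'd::real_vector) \<Rightarrow> nat \<Rightarrow> nat \<Rightarrow>
   ('v list \<Rightarrow> 'b) \<Rightarrow> ('v list \<Rightarrow> 'c) \<Rightarrow> 'v list \<Rightarrow> 'd" where
  "wedge mul k l \<alpha> \<beta> = (\<lambda>us.
     (1 / (fact k * fact l)) *\<^sub>R
       (\<Sum>\<sigma> | \<sigma> permutes {..<k + l}. of_int (sign \<sigma>) *\<^sub>R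
          mul (\<alpha> (map (\<lambda>i. us ! \<sigma> i) [0..<k])) (\<beta> (map (\<lambda>i. us ! \<sigma> i) [k..<k + l]))))"

definition ext_d :: "nat \<Rightarrow> ('a, 'n::finite, 'b::real_normed_vector) form_field \<Rightarrow>
    ('a, 'n, 'b) form_field" where
  "ext_d k \<omega> = (\<lambda>c x us. \<Sum>i\<le>k. (- 1) ^ i *\<^sub>R
     frechet_derivative (\<lambda>y. \<omega> c y (take i us @ drop (Suc i) us)) (at x) (us ! i))"

text \<open>The standard frame \<open>e\<^sub>1, \<dots>, e\<^sub>n\<close> of \<open>\<real>^n\<close>, for a numeral type of \<open>n\<close> elements as index type.\<close>

definition std_frame :: "(real ^ 'n::{finite, comm_ring_1}) list" where
  "std_frame = map (\<lambda>i. axis (of_nat i) 1) [1..<Suc CARD('n)]"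

definition positive_volume_form ::
  "('a, 'n::{finite, comm_ring_1}) chart set \<Rightarrow> ('a, 'n, real) form_field \<Rightarrow> bool" where
  "positive_volume_form A v \<longleftrightarrow>
     smooth_form A CARD('n) v \<and> (\<forall>c\<in>A. \<forall>x\<in>chart_img c. v c x std_frame > 0)"


section \<open>SU(2) and its Lie algebra\<close>

type_synonym cmat = "complex ^ 2 ^ 2"

definition dagger :: "cmat \<Rightarrow> cmat" where
  "dagger A = (\<chi> i j. cnj (A $ j $ i))"

definition SU2 :: "cmat set" where
  "SU2 = {g. dagger g ** g = mat 1 \<and> det g = 1}"

definition su2 :: "cmat set" where
  "su2 = {X. dagger X = - X \<and> trace X = 0}"

definition pauli :: "3 \<Rightarrow> cmat" where
  "pauli i =
     (if i = 1 then vector [vector [0, 1], vector [1, 0]]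
      else if i = 2 then vector [vector [0, - \<i>], vector [\<i>, 0]]
      else vector [vector [1, 0], vector [0, - 1]])"

definition tau :: "3 \<Rightarrow> cmat" where
  "tau k = (\<chi> i j. - (\<i> / 2) * pauli k $ i $ j)"

definition su2_coord :: "3 \<Rightarrow> cmat \<Rightarrow> real" where
  "su2_coord i X = - 2 * Re (trace (X ** tau i))"

lemma su2_coord_expansion:
  assumes "X \<in> su2"
  shows "X = (\<Sum>i\<in>UNIV. su2_coord i X *\<^sub>R tau i)"
proof -
  have *: "cnj (X $ j $ i) = - (X $ i $ j)" for i j
    using assms by (auto simp: su2_def dagger_def vec_eq_iff)
  have tr: "X $ 1 $ 1 + X $ 2 $ 2 = 0"
    using assms by (simp add: su2_def trace_def UNIV_2)
  have r: "Re (X $ 1 $ 1) = 0" "Re (X $ 2 $ 2) = 0"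
    using *[of 1 1] *[of 2 2] by (auto simp: complex_eq_iff)
  have t2: "Im (X $ 2 $ 2) = - Im (X $ 1 $ 1)"
    using tr by (simp add: complex_eq_iff)
  have o: "Re (X $ 2 $ 1) = - Re (X $ 1 $ 2)" "Im (X $ 2 $ 1) = Im (X $ 1 $ 2)"
    using *[of 1 2] by (auto simp: complex_eq_iff)
  show ?thesis
    using r t2 o
    by (auto simp: vec_eq_iff complex_eq_iff forall_2 sum_3 su2_coord_def tau_def pauli_def
        trace_def matrix_matrix_mult_def sum_2 vector_2)
qed


section \<open>Principal SU(2) bundles\<close>

definition smooth_prod_SU2 ::
  "('a::topological_space, 'n::finite) chart set \<Rightarrow> 'a set \<Rightarrow>
   ('b::topological_space, 'k::finite) chart set \<Rightarrow> ('a \<Rightarrow> cmat \<Rightarrow> 'b) \<Rightarrow> bool" where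
  "smooth_prod_SU2 A U B f \<longleftrightarrow>
     continuous_on (U \<times> SU2) (\<lambda>(p, g). f p g) \<and>
     (\<forall>c\<in>A. \<forall>c'\<in>B.
        smooth_on_subset
          {(x, g). x \<in> chart_img c \<and> chart_inv c x \<in> U \<and> g \<in> SU2 \<and> f (chart_inv c x) g \<in> chart_dom c'}
          (\<lambda>(x, g). chart_map c' (f (chart_inv c x) g)))"

text \<open>The diffeomorphism of a local trivialisation over \<open>U\<close> is \<open>p \<mapsto> (\<pi>(p), \<psi>(p))\<close>.\<close>

definition local_trivialisation ::
  "('m::topological_space, 'k::finite) chart set \<Rightarrow> ('p::topological_space, 'n::finite) chart set \<Rightarrow>
   ('p \<Rightarrow> 'm) \<Rightarrow> ('p \<Rightarrow> cmat \<Rightarrow> 'p) \<Rightarrow> 'm set \<Rightarrow> ('p \<Rightarrow> cmat) \<Rightarrow> bool" where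
  "local_trivialisation AM AP proj act U \<psi> \<longleftrightarrow>
     open U \<and>
     bij_betw (\<lambda>p. (proj p, \<psi> p)) (proj -` U) (U \<times> SU2) \<and>
     (\<forall>c\<in>AP. smooth_on_open (chart_map c ` (chart_dom c \<inter> proj -` U)) (\<lambda>x. \<psi> (chart_inv c x))) \<and>
     smooth_prod_SU2 AM U AP (\<lambda>m g. inv_into (proj -` U) (\<lambda>p. (proj p, \<psi> p)) (m, g)) \<and>
     (\<forall>p\<in>proj -` U. \<forall>g\<in>SU2. \<psi> (act p g) = \<psi> p ** g)"

text \<open>That the action is free and transitive on the fibres, and that \<open>proj\<close> is a surjective
  submersion, is implied by local triviality.\<close>

definition principal_SU2_bundle ::
  "('m::topological_space, 'k::finite) chart set \<Rightarrow> ('p::topological_space, 'n::finite) chart set \<Rightarrow>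
   ('p \<Rightarrow> 'm) \<Rightarrow> ('p \<Rightarrow> cmat \<Rightarrow> 'p) \<Rightarrow> bool" where
  "principal_SU2_bundle AM AP proj act \<longleftrightarrow>
     smooth_atlas AM \<and> smooth_atlas AP \<and> smooth_map AP AM proj \<and>
     (\<forall>p. act p (mat 1) = p) \<and>
     (\<forall>p. \<forall>g\<in>SU2. \<forall>h\<in>SU2. act (act p g) h = act p (g ** h)) \<and>
     (\<forall>p. \<forall>g\<in>SU2. proj (act p g) = proj p) \<and>
     smooth_prod_SU2 AP UNIV AP act \<and>
     (\<forall>m. \<exists>U \<psi>. m \<in> U \<and> local_trivialisation AM AP proj act U \<psi>)"

definition su2_valued ::
  "('p, 'n::finite) chart set \<Rightarrow> nat \<Rightarrow> ('p, 'n, cmat) form_field \<Rightarrow> bool" where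
  "su2_valued AP k \<omega> \<longleftrightarrow> (\<forall>c\<in>AP. \<forall>x\<in>chart_img c. \<forall>us. length us = k \<longrightarrow> \<omega> c x us \<in> su2)"

text \<open>\<open>R\<^sub>g\<^sup>* \<omega> = g\<^sup>-\<^sup>1 \<omega> g\<close>\<close>

definition equivariant ::
  "('p, 'n::finite) chart set \<Rightarrow> ('p \<Rightarrow> cmat \<Rightarrow> 'p) \<Rightarrow> nat \<Rightarrow> ('p, 'n, cmat) form_field \<Rightarrow> bool" where
  "equivariant AP act k \<omega> \<longleftrightarrow>
     (\<forall>g\<in>SU2. is_pullback AP AP (\<lambda>p. act p g) k \<omega> (\<lambda>c x us. matrix_inv g ** \<omega> c x us ** g))"

definition horizontal ::
  "('m, 'k::finite) chart set \<Rightarrow> ('p, 'n::finite) chart set \<Rightarrow> ('p \<Rightarrow> 'm) \<Rightarrow> nat \<Rightarrow>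
   ('p, 'n, 'b::zero) form_field \<Rightarrow> bool" where
  "horizontal AM AP proj k \<omega> \<longleftrightarrow>
     (\<forall>c\<in>AP. \<forall>c'\<in>AM. \<forall>p\<in>chart_dom c. proj p \<in> chart_dom c' \<longrightarrow>
        (\<forall>us. length us = k \<and> (\<exists>u\<in>set us. coord_diff c c' proj p u = 0) \<longrightarrow>
           \<omega> c (chart_map c p) us = 0))"

text \<open>The last condition says that \<open>W\<close> sends the fundamental vector field of every
  \<open>X \<in> su(2)\<close> to \<open>X\<close>. The value of this field at \<open>p\<close> is the velocity at \<open>t = 0\<close> of \<open>p \<gamma>(t)\<close>,
  for any curve \<open>\<gamma>\<close> in \<open>SU(2)\<close> through the identity with velocity \<open>X\<close>, for instance
  \<open>\<gamma>(t) = exp (t X)\<close>. In a trivialisation such forms are \<open>g\<^sup>-\<^sup>1 w g + g\<^sup>-\<^sup>1 dg\<close>.\<close>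

definition connection_form ::
  "('p, 'n::finite) chart set \<Rightarrow> ('p \<Rightarrow> cmat \<Rightarrow> 'p) \<Rightarrow> ('p, 'n, cmat) form_field \<Rightarrow> bool" where
  "connection_form AP act W \<longleftrightarrow>
     smooth_form AP 1 W \<and> su2_valued AP 1 W \<and> equivariant AP act 1 W \<and>
     (\<forall>c\<in>AP. \<forall>p\<in>chart_dom c. \<forall>\<gamma> X.
        (\<forall>t. \<gamma> t \<in> SU2) \<and> \<gamma> 0 = mat 1 \<and> (\<gamma> has_vector_derivative X) (at 0) \<longrightarrow>
        W c (chart_map c p) [vector_derivative (\<lambda>t. chart_map c (act p (\<gamma> t))) (at 0)] = X)"

abbreviation mat_wedge ::
  "nat \<Rightarrow> nat \<Rightarrow> ('a, 'n::finite, cmat) form_field \<Rightarrow> ('a, 'n, cmat) form_field \<Rightarrow>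
   ('a, 'n, cmat) form_field" where
  "mat_wedge k l \<omega> \<eta> \<equiv> (\<lambda>c x. wedge (**) k l (\<omega> c x) (\<eta> c x))"

definition curvature :: "('a, 'n::finite, cmat) form_field \<Rightarrow> ('a, 'n, cmat) form_field" where
  "curvature W = (\<lambda>c x us. ext_d 1 W c x us + mat_wedge 1 1 W W c x us)"

definition cov_d ::
  "('a, 'n::finite, cmat) form_field \<Rightarrow> ('a, 'n, cmat) form_field \<Rightarrow> ('a, 'n, cmat) form_field" where
  "cov_d W E = (\<lambda>c x us.
     ext_d 1 E c x us + mat_wedge 1 1 W E c x us + mat_wedge 1 1 E W c x us)"

text \<open>The trace is real for \<open>su(2)\<close>-valued \<open>W\<close>; \<open>Re\<close> only turns it into a real-valued form. The
  same applies to the trace in \<open>frame_density\<close> below.\<close>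

definition chern_simons :: "('a, 'n::finite, cmat) form_field \<Rightarrow> ('a, 'n, real) form_field" where
  "chern_simons W = (\<lambda>c x us.
     Re (trace (mat_wedge 1 2 W (ext_d 1 W) c x us
       + (2 / 3) *\<^sub>R mat_wedge 1 2 W (mat_wedge 1 1 W W) c x us)))"


section \<open>Frames\<close>

definition frame_form ::
  "('m, 'k::finite) chart set \<Rightarrow> ('p, 'n::finite) chart set \<Rightarrow> ('p \<Rightarrow> 'm) \<Rightarrow>
   ('p \<Rightarrow> cmat \<Rightarrow> 'p) \<Rightarrow> ('p, 'n, cmat) form_field \<Rightarrow> bool" where
  "frame_form AM AP proj act E \<longleftrightarrow>
     smooth_form AP 1 E \<and> su2_valued AP 1 E \<and> horizontal AM AP proj 1 E \<and> equivariant AP act 1 E \<and>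
     (\<forall>c\<in>AP. \<forall>x\<in>chart_img c. \<forall>a :: 3 \<Rightarrow> real.
        (\<forall>u. (\<Sum>i\<in>UNIV. a i * su2_coord i (E c x [u])) = 0) \<longrightarrow> (\<forall>i. a i = 0))"

definition frame_density :: "('a, 'n::finite, cmat) form_field \<Rightarrow> ('a, 'n, real) form_field" where
  "frame_density E = (\<lambda>c x us. - (2 / 3) * Re (trace (mat_wedge 1 2 E (mat_wedge 1 1 E E) c x us)))"

definition orientation_compatible ::
  "('m, 3) chart set \<Rightarrow> ('p, 'n::finite) chart set \<Rightarrow> ('p \<Rightarrow> 'm) \<Rightarrow>
   ('p, 'n, cmat) form_field \<Rightarrow> bool" where
  "orientation_compatible AM AP proj E \<longleftrightarrow>
     (\<exists>\<mu>. positive_volume_form AM \<mu> \<and> is_pullback AP AM proj 3 \<mu> (frame_density E))"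


section \<open>Stable 3-forms in six dimensions\<close>

text \<open>The following definitions are pointwise: \<open>v\<close> is a volume form and \<open>\<Omega>\<close> a \<open>3\<close>-form on the
  tangent space \<open>\<real>^6\<close> in coordinates.\<close>

definition contract :: "'v \<Rightarrow> ('v list \<Rightarrow> 'b) \<Rightarrow> 'v list \<Rightarrow> 'b" where
  "contract \<xi> \<omega> = (\<lambda>us. \<omega> (\<xi> # us))"

text \<open>The quotient of two \<open>6\<close>-forms is read off on the standard frame.\<close>

definition hitchin_K ::
  "((real ^ 6) list \<Rightarrow> real) \<Rightarrow> ((real ^ 6) list \<Rightarrow> real) \<Rightarrow>
   ((real ^ 6) list \<Rightarrow> real) \<Rightarrow> (real ^ 6) list \<Rightarrow> real" where
  "hitchin_K v \<Omega> \<alpha> = (\<lambda>us.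
     wedge (*) 1 5 \<alpha> (wedge (*) 2 3 (contract (hd us) \<Omega>) \<Omega>) std_frame / v std_frame)"

definition coord_covector :: "real ^ 6 \<Rightarrow> (real ^ 6) list \<Rightarrow> real" where
  "coord_covector b = (\<lambda>us. hd us \<bullet> b)"

definition hitchin_lambda ::
  "((real ^ 6) list \<Rightarrow> real) \<Rightarrow> ((real ^ 6) list \<Rightarrow> real) \<Rightarrow> real" where
  "hitchin_lambda v \<Omega> =
     1 / 6 * (\<Sum>b\<in>Basis. hitchin_K v \<Omega> (hitchin_K v \<Omega> (coord_covector b)) [b])"

definition hitchin_J ::
  "((real ^ 6) list \<Rightarrow> real) \<Rightarrow> ((real ^ 6) list \<Rightarrow> real) \<Rightarrow>
   ((real ^ 6) list \<Rightarrow> real) \<Rightarrow> (real ^ 6) list \<Rightarrow> real" where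
  "hitchin_J v \<Omega> \<alpha> = (\<lambda>us. hitchin_K v \<Omega> \<alpha> us / sqrt (- hitchin_lambda v \<Omega>))"

text \<open>The transpose of \<open>J\<close>, acting on tangent vectors: \<open>\<alpha>(J\<^sup>T \<xi>) = (J \<alpha>)(\<xi>)\<close>.\<close>

definition hitchin_J_transpose ::
  "((real ^ 6) list \<Rightarrow> real) \<Rightarrow> ((real ^ 6) list \<Rightarrow> real) \<Rightarrow> real ^ 6 \<Rightarrow> real ^ 6" where
  "hitchin_J_transpose v \<Omega> \<xi> = (\<Sum>b\<in>Basis. hitchin_J v \<Omega> (coord_covector b) [\<xi>] *\<^sub>R b)"

text \<open>The action of \<open>J\<close> on \<open>3\<close>-forms is \<open>\<alpha> \<and> \<beta> \<and> \<gamma> \<mapsto> J\<alpha> \<and> J\<beta> \<and> J\<gamma>\<close>.\<close>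

definition hat_form ::
  "((real ^ 6) list \<Rightarrow> real) \<Rightarrow> ((real ^ 6) list \<Rightarrow> real) \<Rightarrow> (real ^ 6) list \<Rightarrow> real" where
  "hat_form v \<Omega> = (\<lambda>us. - \<Omega> (map (hitchin_J_transpose v \<Omega>) us))"

definition stable_negative ::
  "('p, 6) chart set \<Rightarrow> ('p, 6, real) form_field \<Rightarrow> ('p, 6, real) form_field \<Rightarrow> bool" where
  "stable_negative AP v \<Omega> \<longleftrightarrow> (\<forall>c\<in>AP. \<forall>x\<in>chart_img c. hitchin_lambda (v c x) (\<Omega> c x) < 0)"

end

theory Submission
  imports Defs
begin

text \<open>
  Write \<open>W = w\<^sup>k \<tau>\<^sub>k\<close>, \<open>E = e\<^sup>k \<tau>\<^sub>k\<close> and \<open>\<theta> = w + i e\<close>. Since \<open>dW = E \<and> E - W \<and> W\<close>, the Chern-Simons form is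
  \<open>\<Omega> = 1/2 Re (\<theta>\<^sup>1 \<and> \<theta>\<^sup>2 \<and> \<theta>\<^sup>3)\<close>. Negativity of \<open>\<lambda>(\<Omega>)\<close> forces the six forms \<open>w\<^sup>k, e\<^sup>k\<close> to be independent, and then
  \<open>J\<close> is, up to a locally constant sign, the complex structure for which the \<open>\<theta>\<^sup>k\<close> are of type \<open>(1,0)\<close>; so the dual form
  is \<open>1/2 Im (\<theta>\<^sup>1 \<and> \<theta>\<^sup>2 \<and> \<theta>\<^sup>3)\<close> up to that sign. Its exterior derivative is
  \<open>1/2 T\<^sup>k \<and> (w \<and> w - e \<and> e)\<^sub>k\<close> with \<open>T = \<nabla>\<^sub>W E\<close>. Conversely, if this vanishes, then the Bianchi identity
  \<open>[T, E] = 0\<close>, which is \<open>ddW = 0\<close>, together with the vanishing of this \<open>4\<close>-form gives \<open>T = 0\<close> by comparing components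
  in the coframe \<open>w\<^sup>k, e\<^sup>k\<close>. The argument is local on \<open>P\<close>.
\<close>

section \<open>Alternating forms and wedge products\<close>

text \<open>The linear algebra is done once, for a fixed form on \<open>\<real>^6\<close>. At each
  point the six coefficients form a linear map A = (w, e) from the tangent space to
  \<open>\<real>^6\<close>, and \<Omega> is the pullback of \<open>model_form\<close> along A.
  Hitchin's K is natural up to the factor by which A scales 6-forms, so K is the transpose of k g,
  where g = A^-1 J A, J is multiplication by i and k = det A / (2 v); the 1/2 is the value found for
  the model. As g squares to -1, \<lambda> = -k^2, so dividing by sqrt(-\<lambda>) removes the sizes
  of v and det A and leaves only sgn k. This sign is the obstacle: \<open>ext_d\<close>
  differentiates the dual form, so the sign has to be constant near the point and not merely known
  at it. Continuity of the nonvanishing det A provides this. Invertibility of A has to be derived: a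
  kernel vector of A would give K K = 0, hence \<lambda> = 0. The derivative of the dual form rests
  on d\<theta>_k = i T_k - \<theta>_(k+1) \<and> \<theta>_(k+2), with indices mod 3: the products
  without T repeat a factor in d(\<theta>_1 \<and> \<theta>_2 \<and> \<theta>_3) and drop
  out.\<close>

lemma alternating_multilinearD:
  assumes "alternating_multilinear k \<omega>" "length us = k"
  shows "i < k \<Longrightarrow> linear (\<lambda>u. \<omega> (us[i := u]))"
    and "i < k \<Longrightarrow> j < k \<Longrightarrow> i \<noteq> j \<Longrightarrow> us ! i = us ! j \<Longrightarrow> \<omega> us = 0"
  using assms unfolding alternating_multilinear_def by blast+

lemma alternating_multilinear_swap:
  assumes \<omega>: "alternating_multilinear k \<omega>" and us: "length us = k" and ij: "i < k" "j < k" "i \<noteq> j"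
  shows "\<omega> (us[i := us ! j, j := us ! i]) = - \<omega> us"
proof -
  let ?f = "\<lambda>a b. \<omega> (us[i := a, j := b])"
  have l1: "linear (\<lambda>b. ?f a b)" for a
    using alternating_multilinearD(1)[OF \<omega>, of "us[i := a]" j] us ij by simp
  have l2: "linear (\<lambda>a. ?f a b)" for b
    using alternating_multilinearD(1)[OF \<omega>, of "us[j := b]" i] us ij
    by (simp add: list_update_swap)
  have z: "?f a a = 0" for a
    using alternating_multilinearD(2)[OF \<omega>, of "us[i := a, j := a]" i j] us ij by simp
  let ?a = "us ! i" and ?b = "us ! j"
  have "0 = ?f (?a + ?b) (?a + ?b)" by (simp add: z)
  also have "\<dots> = ?f ?a ?a + ?f ?b ?a + (?f ?a ?b + ?f ?b ?b)"
    by (simp add: linear_add[OF l1] linear_add[OF l2])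
  finally have "0 = ?f ?b ?a + ?f ?a ?b" by (simp only: z add_0_left add_0_right)
  moreover have "us[i := ?a, j := ?b] = us" by simp
  ultimately show ?thesis by (simp add: eq_neg_iff_add_eq_0)
qed

lemma permute_list_transpose:
  assumes "i < length us" "j < length us"
  shows "permute_list (Transposition.transpose i j) us = us[i := us ! j, j := us ! i]"
  using assms
  by (intro nth_equalityI) (auto simp: permute_list_def nth_list_update Transposition.transpose_def)

lemma alternating_multilinear_permute:
  assumes \<omega>: "alternating_multilinear k \<omega>" and us: "length us = k" and q: "q permutes {..<k}"
  shows "\<omega> (permute_list q us) = of_int (sign q) *\<^sub>R \<omega> us"
  using q finite_lessThan us
proof (induction arbitrary: us rule: permutes_induct)
  case id
  then show ?case by simp
next
  case (swap a b p)
  have "\<omega> (permute_list (Transposition.transpose a b \<circ> p) us)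
      = \<omega> (permute_list p (permute_list (Transposition.transpose a b) us))"
    using swap.hyps swap.prems by (simp add: permute_list_compose)
  also have "\<dots> = of_int (sign p) *\<^sub>R \<omega> (permute_list (Transposition.transpose a b) us)"
    using swap by simp
  also have "\<dots> = of_int (sign p) *\<^sub>R - \<omega> us"
    using swap by (simp add: permute_list_transpose alternating_multilinear_swap[OF \<omega>])
  also have "\<dots> = of_int (sign (Transposition.transpose a b \<circ> p)) *\<^sub>R \<omega> us"
    using swap by (subst sign_compose) (auto simp: sign_swap_id permutation_swap_id
        intro!: permutes_imp_permutation[of "{..<k}"])
  finally show ?case .
qed

text \<open>Conjugation by the shift i - k turns q into a permutation of {..<l}. This serves to
  identify all summands of a wedge product that differ only by a permutation of the arguments of the
  second factor.\<close>

lemma alternating_multilinear_map_permute: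
  assumes \<omega>: "alternating_multilinear l \<omega>" and q: "q permutes {k..<k + l}"
  shows "\<omega> (map (\<lambda>i. f (q i)) [k..<k + l]) = of_int (sign q) *\<^sub>R \<omega> (map f [k..<k + l])"
proof -
  let ?s = "\<lambda>i. i - k"
  let ?q = "map_permutation {k..<k + l} ?s q"
  have inj: "inj_on ?s {k..<k + l}" by (auto simp: inj_on_def)
  have "?s ` {k..<k + l} = {..<l}"
    by (auto simp: image_iff intro!: bexI[of _ "_ + k"])
  then have bij: "bij_betw ?s {k..<k + l} {..<l}" using inj by (simp add: bij_betw_def)
  have q': "?q permutes {..<l}" by (rule map_permutation_permutes[OF bij q])
  have v: "?q i = q (i + k) - k" if "i < l" for i
    using map_permutation_apply[OF inj, of "i + k" q] that by simp
  have ge: "q (i + k) \<ge> k" if "i < l" for i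
    using permutes_in_image[OF q, of "i + k"] that by simp
  have "map (\<lambda>i. f (q i)) [k..<k + l] = permute_list ?q (map f [k..<k + l])"
    using permutes_in_image[OF q'] ge
    by (intro nth_equalityI) (auto simp: permute_list_def v[symmetric], auto simp: v add.commute)
  then show ?thesis
    using alternating_multilinear_permute[OF \<omega> _ q', of "map f [k..<k + l]"]
      sign_map_permutation[OF inj q] by simp
qed

text \<open>Since \<sigma> is injective and \<open>js\<close> is distinct, argument i occurs at no
  more than one position of the permuted list. With the two blocks of a wedge product as
  \<open>js\<close>, this locates the slot in which a summand depends on u.\<close>

lemma map_nth_update_permutes:
  assumes "\<sigma> permutes {..<n}" "length us = n" "i < n" "set js \<subseteq> {..<n}" "distinct js"
  shows "map (\<lambda>j. us[i := u] ! \<sigma> j) js =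
    (if i \<in> \<sigma> ` set js then (map (\<lambda>j. us ! \<sigma> j) js)[(THE m. m < length js \<and> \<sigma> (js ! m) = i) := u]
     else map (\<lambda>j. us ! \<sigma> j) js)"
proof (cases "i \<in> \<sigma> ` set js")
  case False
  then show ?thesis by (auto intro!: nth_list_update_neq)
next
  case True
  then obtain m where m: "m < length js" "\<sigma> (js ! m) = i" by (auto simp: in_set_conv_nth)
  have un: "m' = m" if "m' < length js" "\<sigma> (js ! m') = i" for m'
    using that m permutes_inj[OF assms(1)] assms(5)
    by (metis injD nth_eq_iff_index_eq)
  have the: "(THE m. m < length js \<and> \<sigma> (js ! m) = i) = m"
    by (rule the_equality) (use m un in blast)+
  have "map (\<lambda>j. us[i := u] ! \<sigma> j) js = (map (\<lambda>j. us ! \<sigma> j) js)[m := u]"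
  proof (rule nth_equalityI)
    fix p assume "p < length (map (\<lambda>j. us[i := u] ! \<sigma> j) js)"
    then have p: "p < length js" by simp
    show "map (\<lambda>j. us[i := u] ! \<sigma> j) js ! p = (map (\<lambda>j. us ! \<sigma> j) js)[m := u] ! p"
    proof (cases "p = m")
      case True
      then show ?thesis using m assms(2,3) by simp
    next
      case False
      then have "\<sigma> (js ! p) \<noteq> i" using un p by blast
      then show ?thesis using False p by simp
    qed
  qed simp
  then show ?thesis unfolding the using True by simp
qed

text \<open>Permuting the arguments by q replaces \<sigma> by q \<circ> \<sigma> in each summand;
  reindexing the sum leaves the sign of q.\<close>

lemma wedge_permute_list:
  assumes us: "length us = k + l" and q: "q permutes {..<k + l}"
  shows "wedge mul k l \<alpha> \<beta> (permute_list q us) = of_int (sign q) *\<^sub>R wedge mul k l \<alpha> \<beta> us"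
proof -
  let ?S = "{\<sigma>. \<sigma> permutes {..<k + l}}"
  define g where "g = (\<lambda>\<sigma>. mul (\<alpha> (map (\<lambda>i. us ! \<sigma> i) [0..<k])) (\<beta> (map (\<lambda>i. us ! \<sigma> i) [k..<k + l])))"
  have *: "permute_list q us ! \<sigma> i = us ! (q \<circ> \<sigma>) i" if "\<sigma> \<in> ?S" "i < k + l" for \<sigma> i
    using that permutes_in_image[of \<sigma> "{..<k + l}" i] us by (auto simp: permute_list_def)
  have g: "mul (\<alpha> (map (\<lambda>i. permute_list q us ! \<sigma> i) [0..<k])) (\<beta> (map (\<lambda>i. permute_list q us ! \<sigma> i) [k..<k + l]))
      = g (q \<circ> \<sigma>)" if "\<sigma> \<in> ?S" for \<sigma>
    unfolding g_def by (intro arg_cong2[where f = mul] arg_cong[where f = \<alpha>] arg_cong[where f = \<beta>] map_cong)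
      (use *[OF that] in auto)
  have s: "of_int (sign \<sigma>) = (of_int (sign q) * of_int (sign (q \<circ> \<sigma>)) :: real)" if "\<sigma> \<in> ?S" for \<sigma>
  proof -
    have "sign (q \<circ> \<sigma>) = sign q * sign \<sigma>"
      using that q by (intro sign_compose permutes_imp_permutation[of "{..<k + l}"]) auto
    then have "sign q * sign (q \<circ> \<sigma>) = sign \<sigma>" by simp
    then show ?thesis by (metis of_int_mult)
  qed
  have "(\<Sum>\<sigma>\<in>?S. of_int (sign \<sigma>) *\<^sub>R g (q \<circ> \<sigma>))
      = (\<Sum>\<sigma>\<in>?S. of_int (sign q) *\<^sub>R (of_int (sign (q \<circ> \<sigma>)) *\<^sub>R g (q \<circ> \<sigma>)))"
    by (intro sum.cong refl) (metis s scaleR_scaleR)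
  also have "\<dots> = of_int (sign q) *\<^sub>R (\<Sum>\<sigma>\<in>?S. of_int (sign \<sigma>) *\<^sub>R g \<sigma>)"
    unfolding scaleR_sum_right[symmetric]
      setum_permutations_compose_left[OF q, of "\<lambda>\<sigma>. of_int (sign \<sigma>) *\<^sub>R g \<sigma>"] ..
  finally have "(\<Sum>\<sigma>\<in>?S. of_int (sign \<sigma>) *\<^sub>R g (q \<circ> \<sigma>))
      = of_int (sign q) *\<^sub>R (\<Sum>\<sigma>\<in>?S. of_int (sign \<sigma>) *\<^sub>R g \<sigma>)" .
  moreover have "wedge mul k l \<alpha> \<beta> (permute_list q us)
      = (1 / (fact k * fact l)) *\<^sub>R (\<Sum>\<sigma>\<in>?S. of_int (sign \<sigma>) *\<^sub>R g (q \<circ> \<sigma>))"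
    unfolding wedge_def by (intro arg_cong2[where f = "(*\<^sub>R)"] sum.cong refl) (simp only: g)
  moreover have "wedge mul k l \<alpha> \<beta> us
      = (1 / (fact k * fact l)) *\<^sub>R (\<Sum>\<sigma>\<in>?S. of_int (sign \<sigma>) *\<^sub>R g \<sigma>)"
    unfolding wedge_def g_def ..
  ultimately show ?thesis by (simp add: scaleR_left_commute)
qed

text \<open>In each summand, argument i enters exactly one of the two factors, which is linear in it
  while the other is constant. If two arguments agree, their transposition fixes the list, so by
  \<open>wedge_permute_list\<close> the value equals its own negative.\<close>

lemma wedge_alternating_multilinear:
  fixes \<alpha> \<beta> :: "'v::real_vector list \<Rightarrow> real"
  assumes \<alpha>: "alternating_multilinear k \<alpha>" and \<beta>: "alternating_multilinear l \<beta>"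
  shows "alternating_multilinear (k + l) (wedge (*) k l \<alpha> \<beta>)"
  unfolding alternating_multilinear_def
proof (intro allI impI conjI)
  fix us :: "'v list" and i
  assume us: "length us = k + l" and i: "i < k + l"
  have "linear (\<lambda>u. \<alpha> (map (\<lambda>j. us[i := u] ! \<sigma> j) [0..<k]) * \<beta> (map (\<lambda>j. us[i := u] ! \<sigma> j) [k..<k + l]))"
    (is "linear (\<lambda>u. ?a u * ?b u)") if \<sigma>: "\<sigma> permutes {..<k + l}" for \<sigma>
  proof -
    have cov: "\<sigma> ` {0..<k} \<union> \<sigma> ` {k..<k + l} = {..<k + l}"
    proof -
      have "{0..<k} \<union> {k..<k + l} = {..<k + l}" by auto
      then show ?thesis using permutes_image[OF \<sigma>] by (metis image_Un)
    qed
    have dis: "\<sigma> ` {0..<k} \<inter> \<sigma> ` {k..<k + l} = {}"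
      using permutes_inj[OF \<sigma>] by (auto simp: inj_eq)
    show ?thesis
    proof (cases "i \<in> \<sigma> ` {0..<k}")
      case True
      then have nb: "i \<notin> \<sigma> ` {k..<k + l}" using dis by blast
      have b: "?b u = \<beta> (map (\<lambda>j. us ! \<sigma> j) [k..<k + l])" for u
        by (subst map_nth_update_permutes[OF \<sigma> us i]) (use nb in auto)
      obtain m where m: "m < k" "\<sigma> m = i" using True by auto
      have the: "(THE m. m < length [0..<k] \<and> \<sigma> ([0..<k] ! m) = i) = m"
        using m permutes_inj[OF \<sigma>] by (intro the_equality) (auto simp: inj_eq)
      have a: "?a u = \<alpha> ((map (\<lambda>j. us ! \<sigma> j) [0..<k])[m := u])" for u
        by (subst map_nth_update_permutes[OF \<sigma> us i]) (use True the in auto)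
      show ?thesis unfolding a b
        using alternating_multilinearD(1)[OF \<alpha>, of "map (\<lambda>j. us ! \<sigma> j) [0..<k]" m] m
        by (auto simp: linear_iff algebra_simps)
    next
      case False
      then have T: "i \<in> \<sigma> ` {k..<k + l}" using cov i by blast
      have a: "?a u = \<alpha> (map (\<lambda>j. us ! \<sigma> j) [0..<k])" for u
        by (subst map_nth_update_permutes[OF \<sigma> us i]) (use False in auto)
      obtain m where m: "m < l" "\<sigma> (k + m) = i" using T
        by (metis atLeastLessThan_iff imageE le_add_diff_inverse nat_add_left_cancel_less)
      have the: "(THE m. m < length [k..<k + l] \<and> \<sigma> ([k..<k + l] ! m) = i) = m"
        using m permutes_inj[OF \<sigma>] by (intro the_equality) (auto simp: inj_eq)
      have b: "?b u = \<beta> ((map (\<lambda>j. us ! \<sigma> j) [k..<k + l])[m := u])" for u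
        by (subst map_nth_update_permutes[OF \<sigma> us i]) (use T the in auto)
      show ?thesis unfolding a b
        using alternating_multilinearD(1)[OF \<beta>, of "map (\<lambda>j. us ! \<sigma> j) [k..<k + l]" m] m
        by (auto simp: linear_iff algebra_simps)
    qed
  qed
  then show "linear (\<lambda>u. wedge (*) k l \<alpha> \<beta> (us[i := u]))"
    unfolding wedge_def
    by (intro linear_compose_scale_right linear_compose_sum ballI) auto
next
  fix us :: "'v list" and i j
  assume us: "length us = k + l"
  show "wedge (*) k l \<alpha> \<beta> us = 0"
    if *: "i < k + l" "j < k + l" "i \<noteq> j \<and> us ! i = us ! j"
  proof -
    have "permute_list (Transposition.transpose i j) us = us"
      using * us by (simp add: permute_list_transpose) (metis list_update_id)
    moreover have "Transposition.transpose i j permutes {..<k + l}"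
      using * by (intro permutes_swap_id) auto
    ultimately have "wedge (*) k l \<alpha> \<beta> us = - wedge (*) k l \<alpha> \<beta> us"
      using wedge_permute_list[OF us, of "Transposition.transpose i j" "(*)" \<alpha> \<beta>] *
      by (simp add: sign_swap_id)
    then show ?thesis by simp
  qed
qed

text \<open>Permutations are grouped by b = \<sigma> 0 and written as
  \<open>transpose 0 b \<circ> q\<close> with q fixing 0. The n! choices of q give equal terms,
  which cancels the factorial. Because the arguments are rearranged by a transposition and not by a
  cyclic shift, every b \<noteq> 0 has the same sign instead of alternating ones.\<close>

lemma wedge_1_left:
  fixes \<alpha> \<beta> :: "'v::real_vector list \<Rightarrow> real"
  assumes \<beta>: "alternating_multilinear n \<beta>"
  shows "wedge (*) 1 n \<alpha> \<beta> us =
    (\<Sum>b<1 + n. (if b = 0 then 1 else - 1) * \<alpha> [us ! b] * \<beta> (map (\<lambda>i. us ! Transposition.transpose 0 b i) [1..<1 + n]))"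
proof -
  have S: "{..<1 + n} = insert 0 {1..<1 + n}" by auto
  have *: "(\<Sum>q | q permutes {1..<1 + n}. of_int (sign (Transposition.transpose 0 b \<circ> q)) *\<^sub>R
          (\<alpha> (map (\<lambda>i. us ! (Transposition.transpose 0 b \<circ> q) i) [0..<1]) *
           \<beta> (map (\<lambda>i. us ! (Transposition.transpose 0 b \<circ> q) i) [1..<1 + n])))
      = fact n * ((if b = 0 then 1 else - 1) * \<alpha> [us ! b] *
           \<beta> (map (\<lambda>i. us ! Transposition.transpose 0 b i) [1..<1 + n]))" (is "?L = fact n * ?R") for b
  proof -
    have "?L = (\<Sum>q | q permutes {1..<1 + n}. ?R)"
    proof (intro sum.cong refl)
      fix q assume "q \<in> {q. q permutes {1..<1 + n}}"
      then have q: "q permutes {1..<1 + n}" by simp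
      have "q 0 = 0" using permutes_not_in[OF q] by simp
      moreover have "sign (Transposition.transpose 0 b \<circ> q) = (if b = 0 then 1 else - 1) * sign q"
        using q by (subst sign_compose) (auto simp: sign_swap_id permutation_swap_id intro: permutes_imp_permutation[rotated])
      moreover have "of_int (sign q) * (of_int (sign q) * x) = x" for x :: real
        by (metis mult.assoc mult_1 of_int_1 of_int_mult sign_idempotent)
      ultimately show "of_int (sign (Transposition.transpose 0 b \<circ> q)) *\<^sub>R
          (\<alpha> (map (\<lambda>i. us ! (Transposition.transpose 0 b \<circ> q) i) [0..<1]) *
           \<beta> (map (\<lambda>i. us ! (Transposition.transpose 0 b \<circ> q) i) [1..<1 + n])) = ?R"
        using alternating_multilinear_map_permute[OF \<beta> q, of "\<lambda>i. us ! Transposition.transpose 0 b i"]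
        by (simp add: mult.left_commute)
    qed
    also have "\<dots> = fact n * ?R"
      using card_permutations[of "{1..<1 + n}" n] by simp
    finally show ?thesis .
  qed
  have "(\<Sum>\<sigma> | \<sigma> permutes {..<1 + n}. of_int (sign \<sigma>) *\<^sub>R
          (\<alpha> (map (\<lambda>i. us ! \<sigma> i) [0..<1]) * \<beta> (map (\<lambda>i. us ! \<sigma> i) [1..<1 + n])))
      = fact n * (\<Sum>b\<in>{..<1 + n}. (if b = 0 then 1 else - 1) * \<alpha> [us ! b] *
           \<beta> (map (\<lambda>i. us ! Transposition.transpose 0 b i) [1..<1 + n]))"
    unfolding S sum_distrib_left by (rule trans[OF sum_over_permutations_insert]) (simp, simp, intro sum.cong refl, rule *)
  then have "wedge (*) 1 n \<alpha> \<beta> us = (1 / (fact 1 * fact n)) * (fact n *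
      (\<Sum>b\<in>{..<1 + n}. (if b = 0 then 1 else - 1) * \<alpha> [us ! b] *
           \<beta> (map (\<lambda>i. us ! Transposition.transpose 0 b i) [1..<1 + n])))"
    by (simp only: wedge_def real_scaleR_def)
  then show ?thesis by (simp del: upt_Suc lessThan_Suc sum.lessThan_Suc)
qed

text \<open>The grouping of \<open>wedge_1_left\<close> is carried out twice: b and then c determine
  the two arguments of \<alpha>, and the remaining n! permutations give equal terms. The factor 1/2
  is what is left of 1 / (2! n!).\<close>

lemma wedge_2_left:
  fixes \<alpha> \<beta> :: "'v::real_vector list \<Rightarrow> real"
  assumes \<beta>: "alternating_multilinear n \<beta>"
  shows "wedge (*) 2 n \<alpha> \<beta> us = 1 / 2 *
    (\<Sum>b<2 + n. \<Sum>c\<in>{1..<2 + n}. (if b = 0 then 1 else - 1) * (if c = 1 then 1 else - 1) *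
       \<alpha> [us ! b, us ! Transposition.transpose 0 b c] *
       \<beta> (map (\<lambda>i. us ! Transposition.transpose 0 b (Transposition.transpose 1 c i)) [2..<2 + n]))"
proof -
  have S: "{..<2 + n} = insert 0 {1..<2 + n}" by auto
  have S1: "{1..<2 + n} = insert 1 {2..<2 + n}" by auto
  let ?t = "\<lambda>b c q. Transposition.transpose 0 b \<circ> (Transposition.transpose 1 c \<circ> q)"
  let ?R = "\<lambda>b c. (if b = 0 then 1 else - 1) * (if c = 1 then 1 else - 1) *
       \<alpha> [us ! b, us ! Transposition.transpose 0 b c] *
       \<beta> (map (\<lambda>i. us ! Transposition.transpose 0 b (Transposition.transpose 1 c i)) [2..<2 + n])"
  have *: "(\<Sum>q | q permutes {2..<2 + n}. of_int (sign (?t b c q)) *\<^sub>R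
          (\<alpha> (map (\<lambda>i. us ! ?t b c q i) [0..<2]) * \<beta> (map (\<lambda>i. us ! ?t b c q i) [2..<2 + n])))
      = fact n * ?R b c" (is "?L = _") if c: "c \<in> insert 1 {2..<2 + n}" for b c
  proof -
    have c1: "c \<ge> 1" using c by auto
    have "?L = (\<Sum>q | q permutes {2..<2 + n}. ?R b c)"
    proof (intro sum.cong refl)
      fix q assume "q \<in> {q. q permutes {2..<2 + n}}"
      then have q: "q permutes {2..<2 + n}" by simp
      have "q 0 = 0" "q 1 = 1" using permutes_not_in[OF q] by simp_all
      moreover have "sign (?t b c q) = (if b = 0 then 1 else - 1) * (if c = 1 then 1 else - 1) * sign q"
      proof -
        have pq: "permutation q" using q by (intro permutes_imp_permutation[of "{2..<2 + n}"]) auto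
        then have "permutation (Transposition.transpose 1 c \<circ> q)"
          by (intro permutation_compose permutation_swap_id)
        then show ?thesis using pq
          by (simp add: sign_compose permutation_swap_id sign_swap_id eq_commute[of 0] eq_commute[of "Suc 0"])
      qed
      moreover have "[0..<2] = [0, 1::nat]" by (simp add: numeral_2_eq_2)
      moreover have "Transposition.transpose (Suc 0) c 0 = 0" using c1 by (auto simp: Transposition.transpose_def)
      moreover have "of_int (sign q) * (of_int (sign q) * x) = x" for x :: real
        by (metis mult.assoc mult_1 of_int_1 of_int_mult sign_idempotent)
      ultimately show "of_int (sign (?t b c q)) *\<^sub>R
          (\<alpha> (map (\<lambda>i. us ! ?t b c q i) [0..<2]) * \<beta> (map (\<lambda>i. us ! ?t b c q i) [2..<2 + n])) = ?R b c"
        using alternating_multilinear_map_permute[OF \<beta> q, of "\<lambda>i. us ! Transposition.transpose 0 b (Transposition.transpose 1 c i)"]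
        by (simp add: mult.left_commute)
    qed
    also have "\<dots> = fact n * ?R b c"
      using card_permutations[of "{2..<2 + n}" n] by simp
    finally show ?thesis .
  qed
  have "(\<Sum>\<sigma> | \<sigma> permutes {..<2 + n}. of_int (sign \<sigma>) *\<^sub>R
          (\<alpha> (map (\<lambda>i. us ! \<sigma> i) [0..<2]) * \<beta> (map (\<lambda>i. us ! \<sigma> i) [2..<2 + n])))
      = fact n * (\<Sum>b<2 + n. \<Sum>c\<in>{1..<2 + n}. ?R b c)"
    unfolding S S1 sum_distrib_left
    by (rule trans[OF sum_over_permutations_insert], simp, simp, intro sum.cong refl,
        rule trans[OF sum_over_permutations_insert], simp, simp, intro sum.cong refl, rule *)
  then have "wedge (*) 2 n \<alpha> \<beta> us = (1 / (fact 2 * fact n)) * (fact n *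
      (\<Sum>b<2 + n. \<Sum>c\<in>{1..<2 + n}. ?R b c))"
    by (simp only: wedge_def real_scaleR_def)
  then show ?thesis by (simp del: upt_Suc)
qed

section \<open>The standard frame of \<open>\<real>^6\<close> and the scaling of 6-forms by
  determinants\<close>

lemma std_frame_6: "(std_frame :: (real ^ 6) list) = map (\<lambda>i. axis (of_nat (Suc i)) 1) [0..<6]"
  unfolding std_frame_def by (simp add: upt_rec)

lemma inj_on_of_nat_Suc_6: "inj_on (\<lambda>i. of_nat (Suc i) :: 6) {..<6}"
  by (auto simp: inj_on_def lessThan_nat_numeral lessThan_Suc)

text \<open>The numeral type 6 is the ring of integers mod 6, so its index 6 is 0. The shift by
  \<open>Suc\<close> matches the list positions 0 to 5 of \<open>std_frame\<close> with the indices
  1 to 6.\<close>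

lemma bij_of_nat_Suc_6: "bij_betw (\<lambda>i. of_nat (Suc i) :: 6) {..<6} UNIV"
  using inj_on_of_nat_Suc_6 unfolding bij_betw_def
  by (intro conjI card_subset_eq) (auto simp: card_image)

lemma UNIV_6: "(UNIV :: 6 set) = {1, 2, 3, 4, 5, 6}"
  using bij_of_nat_Suc_6 by (auto simp: bij_betw_def lessThan_nat_numeral lessThan_Suc)

lemma forall_6: "(\<forall>i::6. P i) \<longleftrightarrow> P 1 \<and> P 2 \<and> P 3 \<and> P 4 \<and> P 5 \<and> P 6"
  by (metis UNIV_6 UNIV_I empty_iff insert_iff)

lemma sum_6: "sum f (UNIV :: 6 set) = f 1 + f 2 + f 3 + f 4 + f 5 + f 6"
  unfolding UNIV_6 by (simp add: algebra_simps)

lemma alternating_multilinear_map: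
  fixes f :: "'v::real_vector \<Rightarrow> 'w::real_vector"
  assumes "linear f" "alternating_multilinear k \<omega>"
  shows "alternating_multilinear k (\<lambda>us. \<omega> (map f us))"
  unfolding alternating_multilinear_def
proof (intro allI impI conjI)
  fix us :: "'v list" and i assume us: "length us = k" and i: "i < k"
  show "linear (\<lambda>u. \<omega> (map f (us[i := u])))"
    using linear_compose[OF assms(1) alternating_multilinearD(1)[OF assms(2), of "map f us" i]] us i
    by (simp add: map_update o_def)
next
  fix us :: "'v list" and i j assume "length us = k" "i < k" "j < k" "i \<noteq> j \<and> us ! i = us ! j"
  then show "\<omega> (map f us) = 0"
    using alternating_multilinearD(2)[OF assms(2), of "map f us" i j] by simp
qed

text \<open>Induction over a factorisation of T into elementary maps, simultaneously for all
  \<omega>, as composition replaces \<omega> by a pullback. The condition on the determinant is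
  built into \<open>P\<close>: it passes to both factors of a composition and makes the case of a
  map with a vanishing coordinate vacuous.\<close>

lemma alternating_multilinear_map_frame:
  fixes T :: "real ^ 6 \<Rightarrow> real ^ 6" and \<omega> :: "(real ^ 6) list \<Rightarrow> real"
  assumes "linear T" "alternating_multilinear 6 \<omega>" "det (matrix T) \<noteq> 0"
  shows "\<omega> (map T std_frame) = det (matrix T) * \<omega> std_frame"
proof -
  define P where "P T \<longleftrightarrow> det (matrix T) \<noteq> 0 \<longrightarrow> (\<forall>\<omega>::(real ^ 6) list \<Rightarrow> real. alternating_multilinear 6 \<omega> \<longrightarrow>
      \<omega> (map T std_frame) = det (matrix T) * \<omega> std_frame)" for T :: "real ^ 6 \<Rightarrow> real ^ 6"
  have len: "length (std_frame :: (real ^ 6) list) = 6" by (simp add: std_frame_def)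
  have nth: "(std_frame :: (real ^ 6) list) ! i = axis (of_nat (Suc i)) 1" if "i < 6" for i
    using that by (simp add: std_frame_6)
  have ex: "\<exists>a<6. m = of_nat (Suc a)" for m :: 6
    using bij_of_nat_Suc_6 UNIV_I[of m] unfolding bij_betw_def by blast
  have inj: "(of_nat (Suc i) :: 6) = of_nat (Suc j) \<longleftrightarrow> i = j" if "i < 6" "j < 6" for i j
    using inj_on_eq_iff[OF inj_on_of_nat_Suc_6, of i j] that by simp
  have "P T"
  proof (rule induct_linear_elementary[OF assms(1)])
    fix f g :: "real ^ 6 \<Rightarrow> real ^ 6"
    assume lf: "linear f" and lg: "linear g" and "P f" "P g"
    then show "P (f \<circ> g)"
      unfolding P_def matrix_compose[OF lg lf] det_mul
      using alternating_multilinear_map[OF lf, of 6] by (fastforce simp: map_map[symmetric] simp del: map_map)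
  next
    fix f :: "real ^ 6 \<Rightarrow> real ^ 6" and i
    assume "linear f" and 0: "\<And>x. f x $ i = 0"
    then have "row i (matrix f) = 0" by (simp add: row_def matrix_def vec_eq_iff)
    then show "P f" unfolding P_def by (simp add: det_zero_row)
  next
    fix c :: "6 \<Rightarrow> real"
    let ?T = "\<lambda>x::real ^ 6. \<chi> i. c i * x $ i"
    have det: "det (matrix ?T) = prod c UNIV"
      by (simp add: axis_def matrix_def det_diagonal)
    have ax: "?T (axis j 1) = c j *\<^sub>R axis j 1" for j
      by (auto simp: vec_eq_iff axis_def)
    have "\<omega> (map ?T std_frame) = prod c UNIV * \<omega> std_frame"
      if \<omega>: "alternating_multilinear 6 \<omega>" for \<omega> :: "(real ^ 6) list \<Rightarrow> real"
    proof -
      \<comment> \<open>The frame vectors are scaled one slot at a time; n counts the slots already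
        done.\<close>
      have step: "\<omega> (map (\<lambda>i. if i < n then ?T (std_frame ! i) else std_frame ! i) [0..<6])
          = (\<Prod>i<n. c (of_nat (Suc i))) * \<omega> std_frame" if "n \<le> 6" for n
        using that
      proof (induction n)
        case 0
        show ?case using map_nth[of "std_frame :: (real ^ 6) list"] by (simp add: len)
      next
        case (Suc n)
        let ?us = "map (\<lambda>i. if i < n then ?T (std_frame ! i) else std_frame ! i) [0..<6]"
        have "map (\<lambda>i. if i < Suc n then ?T (std_frame ! i) else std_frame ! i) [0..<6]
            = ?us[n := c (of_nat (Suc n)) *\<^sub>R ?us ! n]"
          using Suc.prems by (intro nth_equalityI) (auto simp: nth_list_update nth ax less_Suc_eq)
        moreover have "?us[n := std_frame ! n] = ?us"
          by (intro nth_equalityI) (auto simp: nth_list_update)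
        ultimately show ?case
          using linear_scale[OF alternating_multilinearD(1)[OF \<omega>, of ?us n]] Suc by simp
      qed
      have "(\<Prod>i<6. c (of_nat (Suc i))) = prod c UNIV"
        using prod.reindex_bij_betw[OF bij_of_nat_Suc_6, of c] by simp
      moreover have "map (\<lambda>i. if i < 6 then ?T (std_frame ! i) else std_frame ! i) [0..<6] = map ?T std_frame"
        by (intro nth_equalityI) (auto simp: len)
      ultimately show ?thesis using step[of 6] by simp
    qed
    then show "P ?T" unfolding P_def det by simp
  next
    fix m n :: 6 assume "m \<noteq> n"
    let ?T = "\<lambda>x::real ^ 6. \<chi> i. x $ Transposition.transpose m n i"
    obtain a b where ab: "a < 6" "b < 6" "m = of_nat (Suc a)" "n = of_nat (Suc b)"
      using ex by metis
    then have "a \<noteq> b" using \<open>m \<noteq> n\<close> by auto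
    have "(\<chi> i j. if Transposition.transpose m n i = j then 1 else 0) = (\<chi> i j. if j = Transposition.transpose m n i then 1 else (0::real))"
      by (auto intro!: Cart_lambda_cong)
    then have "matrix ?T = transpose (\<chi> i j. mat 1 $ i $ Transposition.transpose m n j)"
      by (auto simp: matrix_eq transpose_def axis_def mat_def matrix_def)
    then have det: "det (matrix ?T) = - 1"
      using \<open>m \<noteq> n\<close> by (simp add: det_permute_columns permutes_swap_id sign_swap_id)
    have ax: "?T (axis j 1) = axis (Transposition.transpose m n j) 1" for j
      by (auto simp: vec_eq_iff axis_def Transposition.transpose_def)
    have eq: "map ?T std_frame = std_frame[a := std_frame ! b, b := std_frame ! a]"
    proof (rule nth_equalityI)
      fix i assume "i < length (map ?T std_frame)"
      then have i: "i < 6" by (simp add: len)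
      have "Transposition.transpose m n (of_nat (Suc i)) = of_nat (Suc (Transposition.transpose a b i))"
        using ab i by (simp add: Transposition.transpose_def inj del: of_nat_Suc)
      then have "map ?T std_frame ! i = axis (of_nat (Suc (Transposition.transpose a b i))) 1"
        using i by (simp add: len nth ax del: of_nat_Suc)
      then show "map ?T std_frame ! i = std_frame[a := std_frame ! b, b := std_frame ! a] ! i"
        using ab i by (auto simp: len nth nth_list_update Transposition.transpose_def simp del: of_nat_Suc)
    qed simp
    show "P ?T" unfolding P_def det
      using eq by (simp add: alternating_multilinear_swap[OF _ len ab(1,2) \<open>a \<noteq> b\<close>])
  next
    fix m n :: 6 assume "m \<noteq> n"
    let ?T = "\<lambda>x::real ^ 6. \<chi> i. if i = m then x $ m + x $ n else x $ i"
    obtain a b where ab: "a < 6" "b < 6" "m = of_nat (Suc a)" "n = of_nat (Suc b)"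
      using ex by metis
    then have "a \<noteq> b" using \<open>m \<noteq> n\<close> by auto
    have "matrix ?T = (\<chi> k. if k = m then row m (mat 1) + 1 *s row n (mat 1) else row k (mat 1))"
      using \<open>m \<noteq> n\<close> by (auto simp: vec_eq_iff matrix_def row_def axis_def mat_def)
    then have det: "det (matrix ?T) = 1"
      using det_row_operation[OF \<open>m \<noteq> n\<close>, of "mat 1 :: real ^ 6 ^ 6" 1] by simp
    have ax: "?T (axis j 1) = (if j = n then axis n 1 + axis m 1 else axis j 1)" for j
      using \<open>m \<noteq> n\<close> by (auto simp: vec_eq_iff axis_def)
    have eq: "map ?T std_frame = std_frame[b := std_frame ! b + std_frame ! a]"
    proof (rule nth_equalityI)
      fix i assume "i < length (map ?T std_frame)"
      then have i: "i < 6" by (simp add: len)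
      have "map ?T std_frame ! i = ?T (axis (of_nat (Suc i)) 1)"
        using i by (simp only: nth_map len nth)
      then have "map ?T std_frame ! i =
          (if of_nat (Suc i) = n then axis n 1 + axis m 1 else axis (of_nat (Suc i)) 1)"
        by (simp only: ax)
      then show "map ?T std_frame ! i = std_frame[b := std_frame ! b + std_frame ! a] ! i"
        using ab i by (auto simp: len nth nth_list_update inj simp del: of_nat_Suc)
    qed simp
    have "\<omega> (map ?T std_frame) = \<omega> std_frame"
      if \<omega>: "alternating_multilinear 6 \<omega>" for \<omega> :: "(real ^ 6) list \<Rightarrow> real"
    proof -
      \<comment> \<open>The shear changes only slot b, by adding the vector of slot a; the extra
        term therefore has a repeated argument.\<close>
      have "\<omega> (std_frame[b := std_frame ! a]) = 0"
        using alternating_multilinearD(2)[OF \<omega>, of "std_frame[b := std_frame ! a]" a b] ab \<open>a \<noteq> b\<close>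
        by (simp add: len)
      then show ?thesis unfolding eq
        by (simp only: linear_add[OF alternating_multilinearD(1)[OF \<omega> len ab(2)]]) simp
    qed
    then show "P ?T" unfolding P_def det by simp
  qed
  then show ?thesis using assms unfolding P_def by simp
qed

section \<open>Hitchin's construction for a pulled back form\<close>

lemma wedge_cong:
  assumes "\<And>vs. length vs = k \<Longrightarrow> \<alpha> vs = \<alpha>' vs" "\<And>vs. length vs = l \<Longrightarrow> \<beta> vs = \<beta>' vs"
  shows "wedge mul k l \<alpha> \<beta> us = wedge mul k l \<alpha>' \<beta>' us"
  unfolding wedge_def using assms by simp

lemma wedge_map:
  assumes "length us = k + l"
  shows "wedge mul k l \<alpha> \<beta> (map T us) = wedge mul k l (\<lambda>vs. \<alpha> (map T vs)) (\<lambda>vs. \<beta> (map T vs)) us"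
proof -
  have "\<sigma> i < length us" if "\<sigma> permutes {..<k + l}" "i < k + l" for \<sigma> i
    using permutes_in_image[OF that(1), of i] that(2) assms by simp
  then have eq: "map (\<lambda>i. map T us ! \<sigma> i) [m..<n] = map (\<lambda>i. T (us ! \<sigma> i)) [m..<n]"
    if "\<sigma> permutes {..<k + l}" "n \<le> k + l" for \<sigma> m n
    using that by simp
  have "mul (\<alpha> (map (\<lambda>i. map T us ! \<sigma> i) [0..<k])) (\<beta> (map (\<lambda>i. map T us ! \<sigma> i) [k..<k + l]))
      = mul (\<alpha> (map T (map (\<lambda>i. us ! \<sigma> i) [0..<k]))) (\<beta> (map T (map (\<lambda>i. us ! \<sigma> i) [k..<k + l])))"
    if "\<sigma> permutes {..<k + l}" for \<sigma>
    using eq[OF that, of k 0] eq[OF that, of "k + l" k] by (simp only: map_map o_def le_add1 order_refl)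
  then show ?thesis
    unfolding wedge_def by (intro arg_cong2[where f = "(*\<^sub>R)"] sum.cong refl) simp
qed

lemma alternating_multilinear_contract:
  assumes "alternating_multilinear (Suc k) \<omega>"
  shows "alternating_multilinear k (contract \<xi> \<omega>)"
  unfolding alternating_multilinear_def contract_def
proof (intro allI impI conjI)
  fix us :: "'a list" and i assume "length us = k" "i < k"
  then show "linear (\<lambda>u. \<omega> (\<xi> # us[i := u]))"
    using alternating_multilinearD(1)[OF assms, of "\<xi> # us" "Suc i"] by simp
next
  fix us :: "'a list" and i j assume "length us = k" "i < k" "j < k" "i \<noteq> j \<and> us ! i = us ! j"
  then show "\<omega> (\<xi> # us) = 0"
    using alternating_multilinearD(2)[OF assms, of "\<xi> # us" "Suc i" "Suc j"] by simp
qed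

definition triple_wedge :: "('v \<Rightarrow> real) \<Rightarrow> ('v \<Rightarrow> real) \<Rightarrow> ('v \<Rightarrow> real) \<Rightarrow> 'v list \<Rightarrow> real" where
  "triple_wedge f g h us =
     f (us ! 0) * (g (us ! 1) * h (us ! 2) - g (us ! 2) * h (us ! 1))
   - f (us ! 1) * (g (us ! 0) * h (us ! 2) - g (us ! 2) * h (us ! 0))
   + f (us ! 2) * (g (us ! 0) * h (us ! 1) - g (us ! 1) * h (us ! 0))"

lemma alternating_multilinear_triple_wedge:
  assumes "linear f" "linear g" "linear h"
  shows "alternating_multilinear 3 (triple_wedge f g h)"
  unfolding alternating_multilinear_def
proof (intro allI impI conjI)
  fix us :: "'a list" and i :: nat assume "length us = 3" "i < 3"
  then show "linear (\<lambda>u. triple_wedge f g h (us[i := u]))"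
    using assms
    by (auto simp: numeral_3_eq_3 less_Suc_eq triple_wedge_def linear_iff algebra_simps length_Suc_conv nth_Cons')
next
  fix us :: "'a list" and i j :: nat assume "length us = 3" "i < 3" "j < 3" "i \<noteq> j \<and> us ! i = us ! j"
  then show "triple_wedge f g h us = 0"
    by (auto simp: numeral_3_eq_3 less_Suc_eq triple_wedge_def length_Suc_conv nth_Cons' algebra_simps)
qed

text \<open>With \<open>z\<^sub>k = u\<^sub>k + i u\<^sub>k\<^sub>+\<^sub>3\<close>, the following is \<open>1/2 Re (dz\<^sub>1 \<and> dz\<^sub>2 \<and> dz\<^sub>3)\<close>, and \<open>model_J\<close> below is the
  multiplication by \<open>i\<close>.\<close>

definition model_form :: "(real ^ 6) list \<Rightarrow> real" where
  "model_form us = 1 / 2 * (triple_wedge (\<lambda>u. u $ 1) (\<lambda>u. u $ 2) (\<lambda>u. u $ 3) us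
     - triple_wedge (\<lambda>u. u $ 1) (\<lambda>u. u $ 5) (\<lambda>u. u $ 6) us
     - triple_wedge (\<lambda>u. u $ 4) (\<lambda>u. u $ 2) (\<lambda>u. u $ 6) us
     - triple_wedge (\<lambda>u. u $ 4) (\<lambda>u. u $ 5) (\<lambda>u. u $ 3) us)"

lemma alternating_multilinear_model_form: "alternating_multilinear 3 model_form"
proof -
  have l: "linear (\<lambda>u::real ^ 6. u $ i)" for i by (simp add: linear_iff)
  note a = alternating_multilinear_triple_wedge[OF l l l]
  show ?thesis
    unfolding alternating_multilinear_def model_form_def
  proof (intro allI impI conjI)
    fix us :: "(real ^ 6) list" and i :: nat assume *: "length us = 3" "i < 3"
    show "linear (\<lambda>u. 1 / 2 * (triple_wedge (\<lambda>u. u $ 1) (\<lambda>u. u $ 2) (\<lambda>u. u $ 3) (us[i := u])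
     - triple_wedge (\<lambda>u. u $ 1) (\<lambda>u. u $ 5) (\<lambda>u. u $ 6) (us[i := u])
     - triple_wedge (\<lambda>u. u $ 4) (\<lambda>u. u $ 2) (\<lambda>u. u $ 6) (us[i := u])
     - triple_wedge (\<lambda>u. u $ 4) (\<lambda>u. u $ 5) (\<lambda>u. u $ 3) (us[i := u])))"
      unfolding real_scaleR_def[symmetric]
      by (intro linear_compose_sub linear_compose_scale_right alternating_multilinearD(1)[OF a *])
  qed (simp add: alternating_multilinearD(2)[OF a])
qed

definition model_J :: "real ^ 6 \<Rightarrow> real ^ 6" where
  "model_J z = (\<chi> i. if i = 1 then - z $ 4 else if i = 2 then - z $ 5 else if i = 3 then - z $ 6
     else if i = 4 then z $ 1 else if i = 5 then z $ 2 else z $ 3)"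

text \<open>These are the ten (2,3)-shuffles. Each occurs twice among the twenty terms of
  \<open>wedge_2_left\<close>, once for each order of the arguments of \<alpha>, which absorbs the
  factor 1/2.\<close>

lemma wedge_2_3_list:
  fixes \<alpha> \<beta> :: "'v::real_vector list \<Rightarrow> real"
  assumes \<alpha>: "alternating_multilinear 2 \<alpha>" and \<beta>: "alternating_multilinear 3 \<beta>"
  shows "wedge (*) 2 3 \<alpha> \<beta> [a, b, c, d, e] =
     \<alpha> [a, b] * \<beta> [c, d, e] - \<alpha> [a, c] * \<beta> [b, d, e] + \<alpha> [a, d] * \<beta> [b, c, e] - \<alpha> [a, e] * \<beta> [b, c, d]
   + \<alpha> [b, c] * \<beta> [a, d, e] - \<alpha> [b, d] * \<beta> [a, c, e] + \<alpha> [b, e] * \<beta> [a, c, d]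
   + \<alpha> [c, d] * \<beta> [a, b, e] - \<alpha> [c, e] * \<beta> [a, b, d] + \<alpha> [d, e] * \<beta> [a, b, c]"
proof -
  have s2: "\<alpha> [y, x] = - \<alpha> [x, y]" for x y
    using alternating_multilinear_swap[OF \<alpha>, of "[x, y]" 0 1] by simp
  have x: "\<beta> [y, x, z] = - \<beta> [x, y, z]" "\<beta> [x, z, y] = - \<beta> [x, y, z]" for x y z
    using alternating_multilinear_swap[OF \<beta>, of "[x, y, z]" 0 1]
      alternating_multilinear_swap[OF \<beta>, of "[x, y, z]" 1 2] by simp_all
  have s3: "\<beta> [x, z, y] = - \<beta> [x, y, z]" "\<beta> [y, x, z] = - \<beta> [x, y, z]" "\<beta> [y, z, x] = \<beta> [x, y, z]"
    "\<beta> [z, x, y] = \<beta> [x, y, z]" "\<beta> [z, y, x] = - \<beta> [x, y, z]" for x y z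
    using x(1)[where x = x and y = y and z = z] x(2)[where x = x and y = y and z = z]
      x(2)[where x = y and y = x and z = z] x(1)[where x = x and y = z and z = y]
      x(1)[where x = y and y = z and z = x] by linarith+
  note s = s2[of b a] s2[of c a] s2[of d a] s2[of e a] s2[of c b] s2[of d b] s2[of e b]
    s2[of d c] s2[of e c] s2[of e d]
  have u: "[2..<2 + 3] = [2, 3, 4::nat]" "{..<2 + 3} = {0, 1, 2, 3, 4::nat}" "{1..<2 + 3} = {1, 2, 3, 4::nat}"
    by (auto simp: upt_rec)
  show ?thesis
    unfolding wedge_2_left[OF \<beta>] u
    by (simp add: Transposition.transpose_def s s3[where x = a and y = b and z = c] s3[where x = a and y = b and z = d] s3[where x = a and y = b and z = e] s3[where x = a and y = c and z = d]
        s3[where x = a and y = c and z = e] s3[where x = a and y = d and z = e] s3[where x = b and y = c and z = d] s3[where x = b and y = c and z = e] s3[where x = b and y = d and z = e] s3[where x = c and y = d and z = e])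
qed

lemma std_frame_6_list:
  "(std_frame :: (real ^ 6) list) = [axis 1 1, axis 2 1, axis 3 1, axis 4 1, axis 5 1, axis 6 1]"
  unfolding std_frame_6 by (simp add: upt_rec)

lemma vec_6_expansion: "(z :: real ^ 6) = (\<Sum>i\<in>UNIV. z $ i *\<^sub>R axis i 1)"
  by (simp add: vec_eq_iff axis_def if_distrib cong: if_cong)

text \<open>The only explicit evaluation of Hitchin's K. The left side is quadratic in the 3-form,
  so for Re (\<open>dz\<^sub>1 \<and> dz\<^sub>2 \<and> dz\<^sub>3\<close>) without the factor 1/2
  of \<open>model_form\<close> the constant would be 2.\<close>

lemma wedge_model_form_std_frame:
  assumes \<alpha>: "linear (\<lambda>u. \<alpha> [u])"
  shows "wedge (*) 1 5 \<alpha> (wedge (*) 2 3 (contract z model_form) model_form) std_frame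
       = 1 / 2 * \<alpha> [model_J z]"
proof -
  have 2: "alternating_multilinear 2 (contract z model_form)"
    using alternating_multilinear_contract[of 2 model_form z] alternating_multilinear_model_form by simp
  note 3 = alternating_multilinear_model_form
  have 5: "alternating_multilinear 5 (wedge (*) 2 3 (contract z model_form) model_form)"
    using wedge_alternating_multilinear[OF 2 3] by simp
  have u: "[1..<1 + 5] = [1, 2, 3, 4, 5::nat]" "{..<1 + 5} = {0, 1, 2, 3, 4, 5::nat}"
    by (auto simp: upt_rec)
  have c: "contract z model_form [x, y] = model_form [z, x, y]" for x y
    by (simp add: contract_def)
  have ax: "axis i 1 $ j = (if i = j then 1 else (0::real))" for i j :: 6
    by (simp add: axis_def)
  have "\<alpha> [model_J z] = (\<Sum>i\<in>UNIV. model_J z $ i * \<alpha> [axis i 1])"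
    by (subst vec_6_expansion[of "model_J z"]) (simp add: linear_sum[OF \<alpha>] linear_scale[OF \<alpha>])
  then show ?thesis
    unfolding wedge_1_left[OF 5] u std_frame_6_list sum_6
    by (simp add: Transposition.transpose_def wedge_2_3_list[OF 2 3] c ax del: axis_eq_0_iff)
      (simp add: model_form_def triple_wedge_def ax model_J_def)
qed

lemma alternating_multilinear_1: "alternating_multilinear 1 \<omega> \<longleftrightarrow> linear (\<lambda>u. \<omega> [u])"
  unfolding alternating_multilinear_def by (auto simp: length_Suc_conv)

text \<open>The situation at one point, where A will be the coframe map formed by the coefficients
  of W and E. Invertibility of A is left open, since it is a consequence of \<lambda> < 0.\<close>

locale pulled_back_form =
  fixes A :: "real ^ 6 \<Rightarrow> real ^ 6" and \<Omega> :: "(real ^ 6) list \<Rightarrow> real"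
  assumes linear_A: "linear A"
    and \<Omega>_eq: "length us = 3 \<Longrightarrow> \<Omega> us = model_form (map A us)"
begin

lemma alternating_\<Omega>: "alternating_multilinear 3 \<Omega>"
proof -
  have "alternating_multilinear 3 (\<lambda>us. model_form (map A us))"
    by (rule alternating_multilinear_map[OF linear_A alternating_multilinear_model_form])
  then show ?thesis by (simp add: alternating_multilinear_def \<Omega>_eq)
qed

lemma alternating_contract_\<Omega>: "alternating_multilinear 2 (contract \<xi> \<Omega>)"
  using alternating_multilinear_contract[of 2 \<Omega> \<xi>] alternating_\<Omega> by simp

lemma alternating_wedge_contract_\<Omega>:
  "alternating_multilinear 5 (wedge (*) 2 3 (contract \<xi> \<Omega>) \<Omega>)"
  using wedge_alternating_multilinear[OF alternating_contract_\<Omega> alternating_\<Omega>] by simp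

text \<open>The 6-form defining K is evaluated on the frame \<open>inv A\<close> applied to
  \<open>std_frame\<close>. As a 6-form it is scaled by 1 / det A there; by naturality of wedge and
  contraction it is also the model expression with A \<xi> in place of \<xi> and the 1-form \<alpha>
  pulled back along \<open>inv A\<close>.\<close>

lemma hitchin_K_nondegenerate:
  assumes det: "det (matrix A) \<noteq> 0" and \<alpha>: "linear (\<lambda>u. \<alpha> [u])"
  shows "hitchin_K v \<Omega> \<alpha> [\<xi>] = det (matrix A) / (2 * v std_frame) * \<alpha> [inv A (model_J (A \<xi>))]"
proof -
  have inj: "inj A" using det_nz_iff_inj[OF linear_A] det by simp
  then have surj: "surj A" using linear_injective_imp_surjective[OF linear_A] by simp
  have lT: "linear (inv A)"
    using inj_linear_imp_inv_linear[OF linear_A inj] .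
  have AT: "A (inv A u) = u" for u by (simp add: surj surj_f_inv_f)
  have "det (matrix A) * det (matrix (inv A)) = 1"
  proof -
    have "A \<circ> inv A = id" by (simp add: fun_eq_iff AT)
    then show ?thesis
      using matrix_compose[OF lT linear_A] by (metis det_mul matrix_id)
  qed
  then have dT: "det (matrix (inv A)) = 1 / det (matrix A)" "det (matrix (inv A)) \<noteq> 0"
    using det by (auto simp: field_simps)
  let ?\<beta> = "wedge (*) 2 3 (contract \<xi> \<Omega>) \<Omega>"
  have "alternating_multilinear (1 + 5) (wedge (*) 1 5 \<alpha> ?\<beta>)"
    using \<alpha> by (intro wedge_alternating_multilinear alternating_wedge_contract_\<Omega>) (simp only: alternating_multilinear_1)
  then have "wedge (*) 1 5 \<alpha> ?\<beta> (map (inv A) std_frame) = 1 / det (matrix A) * wedge (*) 1 5 \<alpha> ?\<beta> std_frame"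
    using alternating_multilinear_map_frame[OF lT _ dT(2)] dT(1) by simp
  moreover have "wedge (*) 1 5 \<alpha> ?\<beta> (map (inv A) std_frame)
      = wedge (*) 1 5 (\<lambda>us. \<alpha> (map (inv A) us)) (\<lambda>us. ?\<beta> (map (inv A) us)) std_frame"
    by (rule wedge_map) (simp add: std_frame_6)
  moreover have "\<dots> = wedge (*) 1 5 (\<lambda>us. \<alpha> (map (inv A) us))
      (wedge (*) 2 3 (contract (A \<xi>) model_form) model_form) std_frame"
  proof (rule wedge_cong[OF refl])
    fix vs :: "(real ^ 6) list" assume "length vs = 5"
    then have "?\<beta> (map (inv A) vs) = wedge (*) 2 3 (\<lambda>us. contract \<xi> \<Omega> (map (inv A) us)) (\<lambda>us. \<Omega> (map (inv A) us)) vs"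
      by (intro wedge_map) simp
    also have "\<dots> = wedge (*) 2 3 (contract (A \<xi>) model_form) model_form vs"
      by (rule wedge_cong) (auto simp: contract_def \<Omega>_eq o_def AT)
    finally show "?\<beta> (map (inv A) vs) = wedge (*) 2 3 (contract (A \<xi>) model_form) model_form vs" .
  qed
  moreover have "linear (\<lambda>u. \<alpha> (map (inv A) [u]))"
    using linear_compose[OF lT \<alpha>] by (simp add: o_def)
  ultimately have "1 / det (matrix A) * wedge (*) 1 5 \<alpha> ?\<beta> std_frame = 1 / 2 * \<alpha> [inv A (model_J (A \<xi>))]"
    using wedge_model_form_std_frame[of "\<lambda>us. \<alpha> (map (inv A) us)" "A \<xi>"] by simp
  then have eq: "wedge (*) 1 5 \<alpha> ?\<beta> std_frame = det (matrix A) / 2 * \<alpha> [inv A (model_J (A \<xi>))]"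
    using det by (simp add: field_simps)
  show ?thesis unfolding hitchin_K_def list.sel eq by simp
qed

end

lemma alternating_multilinear_zero:
  assumes "alternating_multilinear k \<omega>" "length us = k" "0 \<in> set us"
  shows "\<omega> us = 0"
proof -
  obtain i where i: "i < k" "us ! i = 0" using assms by (auto simp: in_set_conv_nth)
  then have "us[i := 0] = us" by (metis list_update_id)
  then show ?thesis using linear_0[OF alternating_multilinearD(1)[OF assms(1,2) i(1)]] by simp
qed

text \<open>In every summand the argument x lands in one of the two factors, and that factor
  vanishes.\<close>

lemma wedge_eq_0:
  fixes \<alpha> \<beta> :: "'v::real_vector list \<Rightarrow> real"
  assumes \<alpha>: "\<And>vs. length vs = k \<Longrightarrow> x \<in> set vs \<Longrightarrow> \<alpha> vs = 0"
    and \<beta>: "\<And>vs. length vs = l \<Longrightarrow> x \<in> set vs \<Longrightarrow> \<beta> vs = 0"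
    and us: "length us = k + l" "x \<in> set us"
  shows "wedge (*) k l \<alpha> \<beta> us = 0"
proof -
  have z: "\<alpha> (map (\<lambda>i. us ! \<sigma> i) [0..<k]) * \<beta> (map (\<lambda>i. us ! \<sigma> i) [k..<k + l]) = 0"
    if \<sigma>: "\<sigma> permutes {..<k + l}" for \<sigma>
  proof -
    obtain m where m: "m < k + l" "x = us ! m" using us by (metis in_set_conv_nth)
    obtain i where i: "i < k + l" "m = \<sigma> i"
      using m permutes_image[OF \<sigma>] by (metis imageE lessThan_iff)
    show ?thesis
    proof (cases "i < k")
      case True
      then have "x \<in> set (map (\<lambda>i. us ! \<sigma> i) [0..<k])" using m i by auto
      then show ?thesis using \<alpha>[of "map (\<lambda>i. us ! \<sigma> i) [0..<k]"] by simp
    next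
      case False
      then have "x \<in> set (map (\<lambda>i. us ! \<sigma> i) [k..<k + l])" using m i by auto
      then show ?thesis using \<beta>[of "map (\<lambda>i. us ! \<sigma> i) [k..<k + l]"] by simp
    qed
  qed
  show ?thesis unfolding wedge_def by (simp add: z)
qed

context pulled_back_form
begin

lemma \<Omega>_kernel: "A x = 0 \<Longrightarrow> length us = 3 \<Longrightarrow> x \<in> set us \<Longrightarrow> \<Omega> us = 0"
  using alternating_multilinear_zero[OF alternating_multilinear_model_form, of "map A us"]
  by (force simp: \<Omega>_eq image_iff)

lemma linear_hitchin_K: "linear (\<lambda>\<xi>. hitchin_K v \<Omega> \<alpha> [\<xi>])"
proof -
  have \<Omega>: "linear (\<lambda>\<xi>. contract \<xi> \<Omega> us)" if "length us = 2" for us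
    using alternating_multilinearD(1)[OF alternating_\<Omega>, of "0 # us" 0] that by (simp add: contract_def)
  have lm: "linear (\<lambda>x. c * f x)" "linear (\<lambda>x. f x * c)" if "linear f" for c :: real and f :: "real ^ 6 \<Rightarrow> real"
    using that by (auto simp: linear_iff algebra_simps)
  show ?thesis
    unfolding hitchin_K_def wedge_def list.sel real_scaleR_def divide_inverse
    by (intro lm linear_compose_sum ballI \<Omega>) simp
qed

text \<open>A kernel vector \<open>x\<close> of \<open>A\<close> annihilates \<open>\<Omega>\<close>, hence also \<open>K \<alpha>\<close> and the \<open>6\<close>-form that defines
  \<open>K (K \<alpha>)\<close>; a \<open>6\<close>-form on \<open>\<real>^6\<close> with a kernel vector is zero.\<close>

lemma hitchin_K_hitchin_K_degenerate:
  assumes A: "A x = 0" "x \<noteq> 0"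
  shows "hitchin_K v \<Omega> (hitchin_K v \<Omega> \<alpha>) [\<xi>] = 0"
proof -
  define \<gamma> where "\<gamma> = hitchin_K v \<Omega> \<alpha>"
  let ?\<beta> = "wedge (*) 2 3 (contract \<xi> \<Omega>) \<Omega>" and ?top = "wedge (*) 1 5 \<gamma> (wedge (*) 2 3 (contract \<xi> \<Omega>) \<Omega>)"
  have "contract x \<Omega> us = 0" if "length us = 2" for us
    using \<Omega>_kernel[OF A(1), of "x # us"] that by (simp add: contract_def)
  then have "wedge (*) 2 3 (contract x \<Omega>) \<Omega> us = 0" for us
    unfolding wedge_def by simp
  then have \<gamma>x: "\<gamma> [x] = 0" unfolding \<gamma>_def hitchin_K_def wedge_def[of _ 1] by simp
  have top: "?top us = 0" if "length us = 6" "x \<in> set us" for us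
  proof (rule wedge_eq_0[where x = x])
    show "\<gamma> vs = 0" if "length vs = 1" "x \<in> set vs" for vs
      using that \<gamma>x by (auto simp: length_Suc_conv)
    show "?\<beta> vs = 0" if "length vs = 5" "x \<in> set vs" for vs
      using that by (intro wedge_eq_0[where x = x]) (auto simp: contract_def intro!: \<Omega>_kernel[OF A(1)])
  qed (use that in auto)
  have alt: "alternating_multilinear 6 ?top"
    using wedge_alternating_multilinear[OF _ alternating_wedge_contract_\<Omega>, of 1 \<gamma> \<xi>] linear_hitchin_K
    unfolding alternating_multilinear_1 \<gamma>_def by simp
  obtain m where m: "x $ m \<noteq> 0" using A(2) by (auto simp: vec_eq_iff)
  have len: "length (std_frame :: (real ^ 6) list) = 6" by (simp add: std_frame_def)
  obtain a where a: "a < 6" "m = of_nat (Suc a)"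
    using bij_of_nat_Suc_6 UNIV_I[of m] unfolding bij_betw_def by blast
  have nth: "(std_frame :: (real ^ 6) list) ! i = axis (of_nat (Suc i)) 1" if "i < 6" for i
    using that by (simp add: std_frame_6)
  let ?f = "\<lambda>u. ?top (std_frame[a := u])"
  have lf: "linear ?f" by (rule alternating_multilinearD(1)[OF alt len a(1)])
  \<comment> \<open>x is put into slot a, where its coordinate is nonzero, and expanded in the
    frame. Every other basis vector already stands in the list, so only that coordinate times the
    value on \<open>std_frame\<close> remains.\<close>
  have "0 = ?f x" using a(1) by (intro top[symmetric]) (auto simp: len intro!: set_update_memI)
  also have "\<dots> = (\<Sum>i\<in>UNIV. x $ i * ?f (axis i 1))"
    by (subst vec_6_expansion[of x]) (simp only: linear_sum[OF lf] linear_scale[OF lf] real_scaleR_def)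
  also have "\<dots> = (\<Sum>i\<in>UNIV. if i = m then x $ m * ?top std_frame else 0)"
  proof (rule sum.cong[OF refl])
    fix i :: 6
    obtain b where b: "b < 6" "i = of_nat (Suc b)"
      using bij_of_nat_Suc_6 UNIV_I[of i] unfolding bij_betw_def by blast
    show "x $ i * ?f (axis i 1) = (if i = m then x $ m * ?top std_frame else 0)"
    proof (cases "i = m")
      case True
      have "std_frame[a := axis m 1] = std_frame" unfolding a(2) nth[OF a(1), symmetric] by simp
      then show ?thesis using True by simp
    next
      case False
      then have "a \<noteq> b" using a b by auto
      then have "?f (axis i 1) = 0"
        using alternating_multilinearD(2)[OF alt, of "std_frame[a := axis i 1]" a b] a b
        by (simp add: len nth del: of_nat_Suc)
      then show ?thesis using False by simp
    qed
  qed
  also have "\<dots> = x $ m * ?top std_frame" by simp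
  finally have "?top std_frame = 0" using m by simp
  then show ?thesis unfolding hitchin_K_def \<gamma>_def[symmetric] by (simp add: \<gamma>_def hitchin_K_def)
qed

lemma linear_coord_covector: "linear (\<lambda>u. coord_covector b [u])"
  by (simp add: coord_covector_def linear_iff inner_left_distrib)

lemma hitchin_lambda_degenerate:
  assumes "det (matrix A) = 0"
  shows "hitchin_lambda v \<Omega> = 0"
proof -
  obtain x where "A x = 0" "x \<noteq> 0"
    using det_nz_iff_inj[OF linear_A] linear_injective_0[OF linear_A] assms by blast
  then show ?thesis unfolding hitchin_lambda_def by (simp add: hitchin_K_hitchin_K_degenerate)
qed

lemma model_J_model_J: "model_J (model_J z) = - z"
  using UNIV_6 by (auto simp: vec_eq_iff model_J_def forall_6)

text \<open>K \<alpha> = k (\<alpha> \<circ> g) with g = A^-1 J A and g g = -1. Each of the six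
  diagonal entries of K K is -k^2, so \<lambda> = -k^2 and the transpose of Hitchin's J is sgn k
  times g. Acting on three slots gives (sgn k)^3 = sgn k, and the leading minus is the one in
  \<open>hat_form\<close>.\<close>

lemma hat_form_eq:
  assumes v: "v std_frame \<noteq> 0" and neg: "hitchin_lambda v \<Omega> < 0" and us: "length us = 3"
  shows "det (matrix A) \<noteq> 0"
    and "hat_form v \<Omega> us = - sgn (det (matrix A) / v std_frame) * model_form (map (\<lambda>u. model_J (A u)) us)"
proof -
  show det: "det (matrix A) \<noteq> 0"
    using hitchin_lambda_degenerate neg by force
  then have inj: "inj A" using det_nz_iff_inj[OF linear_A] by simp
  then have surj: "surj A" using linear_injective_imp_surjective[OF linear_A] by simp
  have AT: "A (inv A u) = u" "inv A (A u) = u" for u by (simp_all add: surj surj_f_inv_f inj)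
  have lT: "linear (inv A)" using inj_linear_imp_inv_linear[OF linear_A inj] .
  define k where "k = det (matrix A) / (2 * v std_frame)"
  define g where "g = (\<lambda>u. inv A (model_J (A u)))"
  have gg: "g (g u) = - u" for u
    by (simp add: g_def AT model_J_model_J linear_neg[OF lT])
  have K: "hitchin_K v \<Omega> \<alpha> [\<xi>] = k * \<alpha> [g \<xi>]" if "linear (\<lambda>u. \<alpha> [u])" for \<alpha> \<xi>
    unfolding k_def g_def by (rule hitchin_K_nondegenerate[OF det that])
  have k: "k \<noteq> 0" using det v by (simp add: k_def)
  have KK: "hitchin_K v \<Omega> (hitchin_K v \<Omega> (coord_covector b)) [b] = - (k\<^sup>2)" if "b \<in> Basis" for b
    using that unfolding K[OF linear_hitchin_K] K[OF linear_coord_covector] gg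
    by (simp add: coord_covector_def inner_Basis power2_eq_square)
  have "hitchin_lambda v \<Omega> = - (k\<^sup>2)"
    unfolding hitchin_lambda_def by (simp add: KK)
  then have sq: "sqrt (- hitchin_lambda v \<Omega>) = \<bar>k\<bar>" by simp
  have J: "hitchin_J_transpose v \<Omega> \<xi> = sgn k *\<^sub>R g \<xi>" for \<xi>
  proof -
    have "hitchin_J_transpose v \<Omega> \<xi> = (\<Sum>b\<in>Basis. (sgn k * (g \<xi> \<bullet> b)) *\<^sub>R b)"
      unfolding hitchin_J_transpose_def hitchin_J_def sq K[OF linear_coord_covector]
      by (simp add: coord_covector_def sgn_div_norm divide_inverse mult_ac)
    also have "\<dots> = sgn k *\<^sub>R g \<xi>"
      using euclidean_representation[of "g \<xi>"] by (simp add: scaleR_scaleR[symmetric] scaleR_sum_right[symmetric] del: scaleR_scaleR)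
    finally show ?thesis .
  qed
  obtain a b c where abc: "us = [a, b, c]" using us by (auto simp: numeral_3_eq_3 length_Suc_conv)
  have "hat_form v \<Omega> us = - model_form [sgn k *\<^sub>R model_J (A a), sgn k *\<^sub>R model_J (A b), sgn k *\<^sub>R model_J (A c)]"
    unfolding hat_form_def abc by (simp add: \<Omega>_eq J linear_scale[OF linear_A]) (simp add: g_def AT)
  also have "\<dots> = - (sgn k ^ 3) * model_form [model_J (A a), model_J (A b), model_J (A c)]"
    by (simp add: model_form_def triple_wedge_def power3_eq_cube algebra_simps)
  also have "sgn k ^ 3 = sgn k" by (simp add: sgn_if)
  also have "sgn k = sgn (det (matrix A) / v std_frame)"
    by (simp add: k_def sgn_divide sgn_mult)
  finally show "hat_form v \<Omega> us = - sgn (det (matrix A) / v std_frame) * model_form (map (\<lambda>u. model_J (A u)) us)"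
    by (simp add: abc)
qed

end

section \<open>Exterior derivatives\<close>

lemma mixed_difference_mean_value:
  fixes f :: "'a::euclidean_space \<Rightarrow> real"
  assumes ball: "ball x r \<subseteq> S" and h: "0 < h" "h * (norm u + norm v) < r"
    and f: "\<And>y. y \<in> S \<Longrightarrow> f differentiable (at y)"
    and fu: "\<And>y. y \<in> S \<Longrightarrow> (\<lambda>y. frechet_derivative f (at y) u) differentiable (at y)"
  obtains y where "dist y x \<le> h * (norm u + norm v)"
    "f (x + h *\<^sub>R u + h *\<^sub>R v) - f (x + h *\<^sub>R u) - f (x + h *\<^sub>R v) + f x
     = h * h * frechet_derivative (\<lambda>y. frechet_derivative f (at y) u) (at y) v"
proof -
  have near: "norm (s *\<^sub>R u + t *\<^sub>R v) \<le> h * (norm u + norm v)"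
    if "0 \<le> s" "s \<le> h" "0 \<le> t" "t \<le> h" for s t
  proof -
    have "norm (s *\<^sub>R u + t *\<^sub>R v) \<le> norm (s *\<^sub>R u) + norm (t *\<^sub>R v)" by (rule norm_triangle_ineq)
    also have "\<dots> \<le> h * norm u + h * norm v"
      using that by (intro add_mono) (auto intro: mult_right_mono)
    finally show ?thesis by (simp add: algebra_simps)
  qed
  have inS: "x + s *\<^sub>R u + t *\<^sub>R v \<in> S" if "0 \<le> s" "s \<le> h" "0 \<le> t" "t \<le> h" for s t
  proof -
    have "dist (x + s *\<^sub>R u + t *\<^sub>R v) x = norm (s *\<^sub>R u + t *\<^sub>R v)"
      by (simp add: dist_norm add.assoc)
    then have "x + s *\<^sub>R u + t *\<^sub>R v \<in> ball x r"
      using near[OF that] h(2) by (simp add: dist_commute)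
    then show ?thesis using ball by blast
  qed
  have line: "((\<lambda>s. g (p + s *\<^sub>R d)) has_real_derivative frechet_derivative g (at (p + s *\<^sub>R d)) d) (at s)"
    if "g differentiable (at (p + s *\<^sub>R d))" for g :: "'a \<Rightarrow> real" and p d s
  proof -
    have "((\<lambda>s. g (p + s *\<^sub>R d)) has_derivative (\<lambda>t. frechet_derivative g (at (p + s *\<^sub>R d)) (t *\<^sub>R d))) (at s)"
      by (rule has_derivative_compose[of "\<lambda>s. p + s *\<^sub>R d" "\<lambda>t. t *\<^sub>R d"])
        (auto intro!: derivative_eq_intros simp: frechet_derivative_works[symmetric] that)
    moreover have "frechet_derivative g (at (p + s *\<^sub>R d)) (t *\<^sub>R d) = frechet_derivative g (at (p + s *\<^sub>R d)) d * t" for t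
      using linear_scale[OF linear_frechet_derivative[OF that]] by simp
    ultimately show ?thesis by (simp add: has_field_derivative_def)
  qed
  \<comment> \<open>The second difference is the increment of \<phi> over [0, h]. The mean value
    theorem is used for \<phi> in direction u, and then in direction v for the derivative
    obtained.\<close>
  let ?\<phi> = "\<lambda>s. f ((x + h *\<^sub>R v) + s *\<^sub>R u) - f (x + s *\<^sub>R u)"
  let ?fu = "\<lambda>y. frechet_derivative f (at y) u"
  have "(?\<phi> has_real_derivative ?fu ((x + h *\<^sub>R v) + s *\<^sub>R u) - ?fu (x + s *\<^sub>R u)) (at s)"
    if "0 \<le> s" "s \<le> h" for s
    using inS[of s h] inS[of s 0] that h(1)
    by (intro DERIV_diff line f) (auto simp: algebra_simps)
  then obtain s where s: "0 < s" "s < h"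
    and 1: "?\<phi> h - ?\<phi> 0 = (h - 0) * (?fu ((x + h *\<^sub>R v) + s *\<^sub>R u) - ?fu (x + s *\<^sub>R u))"
    using MVT2[of 0 h ?\<phi> "\<lambda>s. ?fu ((x + h *\<^sub>R v) + s *\<^sub>R u) - ?fu (x + s *\<^sub>R u)"] h(1) by auto
  let ?\<psi> = "\<lambda>t. ?fu ((x + s *\<^sub>R u) + t *\<^sub>R v)"
  let ?d = "\<lambda>t. frechet_derivative ?fu (at ((x + s *\<^sub>R u) + t *\<^sub>R v)) v"
  have "(?\<psi> has_real_derivative ?d t) (at t)" if "0 \<le> t" "t \<le> h" for t
    using inS[of s t] that s by (intro line fu) auto
  then obtain t where t: "0 < t" "t < h" and 2: "?\<psi> h - ?\<psi> 0 = (h - 0) * ?d t"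
    using MVT2[of 0 h ?\<psi> ?d] h(1) by auto
  show thesis
  proof
    show "dist (x + s *\<^sub>R u + t *\<^sub>R v) x \<le> h * (norm u + norm v)"
      using near[of s t] s t by (simp add: dist_norm add.assoc)
    show "f (x + h *\<^sub>R u + h *\<^sub>R v) - f (x + h *\<^sub>R u) - f (x + h *\<^sub>R v) + f x
     = h * h * frechet_derivative ?fu (at (x + s *\<^sub>R u + t *\<^sub>R v)) v"
      using 1 2 by (simp add: algebra_simps)
  qed
qed

text \<open>The second difference is symmetric in u and v. Thus the two mixed derivatives agree at
  suitable points y and z close to x; if they differed at x, continuity would keep each within half
  the gap of its value at x, a contradiction.\<close>

lemma frechet_derivative_commute:
  fixes f :: "'a::euclidean_space \<Rightarrow> real"
  assumes S: "open S" "x \<in> S"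
    and f: "\<And>y. y \<in> S \<Longrightarrow> f differentiable (at y)"
    and fu: "\<And>u y. y \<in> S \<Longrightarrow> (\<lambda>y. frechet_derivative f (at y) u) differentiable (at y)"
    and cont: "\<And>u v. continuous_on S (\<lambda>y. frechet_derivative (\<lambda>y. frechet_derivative f (at y) u) (at y) v)"
  shows "frechet_derivative (\<lambda>y. frechet_derivative f (at y) u) (at x) v
       = frechet_derivative (\<lambda>y. frechet_derivative f (at y) v) (at x) u"
proof (rule ccontr)
  let ?F = "\<lambda>u v y. frechet_derivative (\<lambda>y. frechet_derivative f (at y) u) (at y) v"
  assume "?F u v x \<noteq> ?F v u x"
  then have "\<bar>?F u v x - ?F v u x\<bar> / 2 > 0" (is "?e > 0") by simp
  obtain r where r: "r > 0" "ball x r \<subseteq> S" using S open_contains_ball by blast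
  have "\<exists>d>0. \<forall>y\<in>S. dist y x < d \<longrightarrow> dist (?F u v y) (?F u v x) < ?e"
    using cont[of u v] S(2) \<open>?e > 0\<close> unfolding continuous_on_iff by blast
  then obtain d1 where d1: "d1 > 0" "\<And>y. y \<in> S \<Longrightarrow> dist y x < d1 \<Longrightarrow> dist (?F u v y) (?F u v x) < ?e" by blast
  have "\<exists>d>0. \<forall>y\<in>S. dist y x < d \<longrightarrow> dist (?F v u y) (?F v u x) < ?e"
    using cont[of v u] S(2) \<open>?e > 0\<close> unfolding continuous_on_iff by blast
  then obtain d2 where d2: "d2 > 0" "\<And>y. y \<in> S \<Longrightarrow> dist y x < d2 \<Longrightarrow> dist (?F v u y) (?F v u x) < ?e" by blast
  define m where "m = Min {r, d1, d2}"
  have m: "m > 0" "m \<le> r" "m \<le> d1" "m \<le> d2" using r d1 d2 by (auto simp: m_def)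
  \<comment> \<open>The summand 1 keeps N positive and the bound strict even if u = v = 0.\<close>
  define N where "N = norm u + norm v + 1"
  have N: "N > 0" "norm u + norm v < N" by (auto simp: N_def add_nonneg_pos)
  define h where "h = m / N"
  have "h > 0" "h * N = m" using m N by (auto simp: h_def)
  then have h: "h > 0" "h * (norm u + norm v) < m"
    using mult_strict_left_mono[OF N(2), of h] by simp_all
  have hr: "h * (norm u + norm v) < r" using h m by simp
  obtain y where y: "dist y x \<le> h * (norm u + norm v)"
    "f (x + h *\<^sub>R u + h *\<^sub>R v) - f (x + h *\<^sub>R u) - f (x + h *\<^sub>R v) + f x = h * h * ?F u v y"
    by (rule mixed_difference_mean_value[OF r(2) h(1) hr f fu])
  obtain z where z: "dist z x \<le> h * (norm v + norm u)"
    "f (x + h *\<^sub>R v + h *\<^sub>R u) - f (x + h *\<^sub>R v) - f (x + h *\<^sub>R u) + f x = h * h * ?F v u z"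
    by (rule mixed_difference_mean_value[OF r(2) h(1) hr[unfolded add.commute[of "norm u"]] f fu])
  have "h * h * ?F u v y = h * h * ?F v u z"
    unfolding y(2)[symmetric] z(2)[symmetric] by (simp add: algebra_simps)
  then have "?F u v y = ?F v u z" using h(1) by simp
  moreover have "dist (?F u v y) (?F u v x) < ?e"
    using y(1) h m r(2) by (intro d1) (auto simp: subset_iff dist_commute)
  moreover have "dist (?F v u z) (?F v u x) < ?e"
    using z(1) h m r(2) by (intro d2) (auto simp: subset_iff dist_commute add.commute)
  ultimately show False by (simp add: dist_real_def abs_if split: if_splits)
qed

section \<open>Smooth functions on open sets\<close>

lemma smooth_on_openD:
  assumes "smooth_on_open S f" "y \<in> S"
  shows "f differentiable (at y)" "smooth_on_open S (\<lambda>y. frechet_derivative f (at y) u)"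
proof -
  have c: "cont_diff_on (Suc n) S f" for n using assms unfolding smooth_on_open_def by blast
  show "f differentiable (at y)" using c[of 0] assms(2) by simp
  show "smooth_on_open S (\<lambda>y. frechet_derivative f (at y) u)"
    using c unfolding smooth_on_open_def by simp
qed

lemma smooth_on_open_continuous_on: "smooth_on_open S f \<Longrightarrow> continuous_on S f"
  unfolding smooth_on_open_def by (metis cont_diff_on.simps(1))

lemma smooth_on_open_frechet_derivative_commute:
  fixes f :: "'a::euclidean_space \<Rightarrow> real"
  assumes "open S" "x \<in> S" "smooth_on_open S f"
  shows "frechet_derivative (\<lambda>y. frechet_derivative f (at y) u) (at x) v
       = frechet_derivative (\<lambda>y. frechet_derivative f (at y) v) (at x) u"
proof -
  note fu = smooth_on_openD(2)[OF assms(3,2)]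
  show ?thesis
    by (rule frechet_derivative_commute[OF assms(1,2) smooth_on_openD(1)[OF assms(3)] smooth_on_openD(1)[OF fu]
          smooth_on_open_continuous_on[OF smooth_on_openD(2)[OF fu assms(2)]]])
qed

lemma frechet_derivative_cong_open:
  assumes "open S" "x \<in> S" "\<And>y. y \<in> S \<Longrightarrow> f y = g y"
  shows "frechet_derivative f (at x) = frechet_derivative g (at x)"
proof -
  have "(f has_derivative D) (at x) \<longleftrightarrow> (g has_derivative D) (at x)" for D
    using has_derivative_transform_within_open[of f D x UNIV S g]
      has_derivative_transform_within_open[of g D x UNIV S f] assms by auto
  then show ?thesis unfolding frechet_derivative_def by simp
qed

text \<open>\<open>cont_diff_on\<close> iterates \<open>frechet_derivative\<close> of total
  functions, so agreement on S has to be carried through every order. Openness of S makes the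
  derivatives at its points agree again.\<close>

lemma cont_diff_on_cong:
  assumes "open S" "\<And>y. y \<in> S \<Longrightarrow> f y = g y" "cont_diff_on n S f"
  shows "cont_diff_on n S g"
  using assms(2,3)
proof (induction n arbitrary: f g)
  case 0
  then show ?case by (simp cong: continuous_on_cong)
next
  case (Suc n)
  have "g differentiable (at x)" if x: "x \<in> S" for x
  proof -
    obtain D where "(f has_derivative D) (at x)"
      using Suc.prems(2) x differentiable_def[of f] by auto
    then have "(g has_derivative D) (at x)"
      using has_derivative_transform_within_open[OF _ assms(1) x] Suc.prems(1) by blast
    then show ?thesis unfolding differentiable_def by blast
  qed
  moreover have "cont_diff_on n S (\<lambda>x. frechet_derivative g (at x) u)" for u
  proof (rule Suc.IH)
    show "cont_diff_on n S (\<lambda>x. frechet_derivative f (at x) u)" using Suc.prems(2) by simp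
    show "frechet_derivative f (at y) u = frechet_derivative g (at y) u" if "y \<in> S" for y
      using frechet_derivative_cong_open[OF assms(1) that Suc.prems(1)] by simp
  qed
  ultimately show ?case by simp
qed

lemma frechet_derivative_bounded_linear:
  assumes "bounded_linear L" "f differentiable (at x)"
  shows "frechet_derivative (\<lambda>x. L (f x)) (at x) u = L (frechet_derivative f (at x) u)"
proof -
  have "((\<lambda>x. L (f x)) has_derivative (\<lambda>u. L (frechet_derivative f (at x) u))) (at x)"
    using bounded_linear.has_derivative[OF assms(1)] assms(2) frechet_derivative_works by blast
  then show ?thesis by (metis frechet_derivative_at)
qed

lemma smooth_on_open_bounded_linear:
  assumes "open S" "bounded_linear L" "smooth_on_open S f"
  shows "smooth_on_open S (\<lambda>x. L (f x))"
proof -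
  have "cont_diff_on n S (\<lambda>x. L (f x))" if "cont_diff_on n S f" for n f
    using that
  proof (induction n arbitrary: f)
    case 0
    then show ?case using bounded_linear.continuous_on[OF assms(2)] by simp
  next
    case (Suc n)
    have "(\<lambda>x. L (f x)) differentiable (at x)" if x: "x \<in> S" for x
    proof -
      obtain D where "(f has_derivative D) (at x)"
        using Suc.prems x differentiable_def[of f] by auto
      then show ?thesis
        using bounded_linear.has_derivative[OF assms(2)] unfolding differentiable_def by blast
    qed
    moreover have "cont_diff_on n S (\<lambda>x. frechet_derivative (\<lambda>x. L (f x)) (at x) u)" for u
    proof (rule cont_diff_on_cong[OF assms(1)])
      show "cont_diff_on n S (\<lambda>x. L (frechet_derivative f (at x) u))" using Suc by simp
      show "L (frechet_derivative f (at y) u) = frechet_derivative (\<lambda>x. L (f x)) (at y) u" if "y \<in> S" for y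
        using frechet_derivative_bounded_linear[OF assms(2), of f y u] Suc.prems that by simp
    qed
    ultimately show ?case by simp
  qed
  then show ?thesis using assms(3) unfolding smooth_on_open_def by blast
qed

text \<open>At a fixed point, forms are given by their values on separate arguments here; \<open>wedgekl\<close> multiplies a
  \<open>k\<close>-form by an \<open>l\<close>-form, and \<open>dform1\<close> is the exterior derivative of a \<open>1\<close>-form.\<close>

definition wedge11 :: "('v \<Rightarrow> real) \<Rightarrow> ('v \<Rightarrow> real) \<Rightarrow> 'v \<Rightarrow> 'v \<Rightarrow> real" where
  "wedge11 f g a b = f a * g b - f b * g a"

definition wedge21 :: "('v \<Rightarrow> 'v \<Rightarrow> real) \<Rightarrow> ('v \<Rightarrow> real) \<Rightarrow> 'v \<Rightarrow> 'v \<Rightarrow> 'v \<Rightarrow> real" where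
  "wedge21 p f a b c = p a b * f c - p a c * f b + p b c * f a"

definition wedge22 :: "('v \<Rightarrow> 'v \<Rightarrow> real) \<Rightarrow> ('v \<Rightarrow> 'v \<Rightarrow> real) \<Rightarrow> 'v \<Rightarrow> 'v \<Rightarrow> 'v \<Rightarrow> 'v \<Rightarrow> real" where
  "wedge22 p q a b c d = p a b * q c d - p a c * q b d + p a d * q b c
     + p b c * q a d - p b d * q a c + p c d * q a b"

definition dform1 :: "('v::euclidean_space \<Rightarrow> 'v \<Rightarrow> real) \<Rightarrow> 'v \<Rightarrow> 'v \<Rightarrow> 'v \<Rightarrow> real" where
  "dform1 f x a b = frechet_derivative (\<lambda>y. f y b) (at x) a - frechet_derivative (\<lambda>y. f y a) (at x) b"

section \<open>Leibniz rules and identities for wedge products\<close>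

lemma dform_wedge11:
  fixes f g :: "'v::euclidean_space \<Rightarrow> 'v \<Rightarrow> real"
  assumes f: "\<And>u. (\<lambda>y. f y u) differentiable (at x)" and g: "\<And>u. (\<lambda>y. g y u) differentiable (at x)"
  shows "(\<lambda>y. wedge11 (f y) (g y) a b) differentiable (at x)"
    and "frechet_derivative (\<lambda>y. wedge11 (f y) (g y) b c) (at x) a
     - frechet_derivative (\<lambda>y. wedge11 (f y) (g y) a c) (at x) b
     + frechet_derivative (\<lambda>y. wedge11 (f y) (g y) a b) (at x) c
     = wedge21 (dform1 f x) (g x) a b c - wedge21 (dform1 g x) (f x) a b c"
proof -
  note Df = frechet_derivative_works[THEN iffD1, OF f] and Dg = frechet_derivative_works[THEN iffD1, OF g]
  have D: "((\<lambda>y. wedge11 (f y) (g y) b c) has_derivative (\<lambda>u.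
      f x b * frechet_derivative (\<lambda>y. g y c) (at x) u + frechet_derivative (\<lambda>y. f y b) (at x) u * g x c
    - (f x c * frechet_derivative (\<lambda>y. g y b) (at x) u + frechet_derivative (\<lambda>y. f y c) (at x) u * g x b))) (at x)" for b c
    unfolding wedge11_def by (intro has_derivative_diff has_derivative_mult Df Dg)
  show "(\<lambda>y. wedge11 (f y) (g y) a b) differentiable (at x)"
    using D[of a b] unfolding differentiable_def by blast
  show "frechet_derivative (\<lambda>y. wedge11 (f y) (g y) b c) (at x) a
     - frechet_derivative (\<lambda>y. wedge11 (f y) (g y) a c) (at x) b
     + frechet_derivative (\<lambda>y. wedge11 (f y) (g y) a b) (at x) c
     = wedge21 (dform1 f x) (g x) a b c - wedge21 (dform1 g x) (f x) a b c"
    unfolding D[THEN frechet_derivative_at, symmetric]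
    by (simp add: wedge21_def dform1_def algebra_simps)
qed

text \<open>Leibniz rule df \<and> g \<and> h - f \<and> dg \<and> h + f \<and> g \<and> dh; each
  2-form is moved to the front, which costs no sign.\<close>

lemma dform_triple_wedge:
  fixes f g h :: "'v::euclidean_space \<Rightarrow> 'v \<Rightarrow> real"
  assumes f: "\<And>u. (\<lambda>y. f y u) differentiable (at x)" and g: "\<And>u. (\<lambda>y. g y u) differentiable (at x)"
    and h: "\<And>u. (\<lambda>y. h y u) differentiable (at x)"
  shows "(\<lambda>y. triple_wedge (f y) (g y) (h y) [a, b, c]) differentiable (at x)"
    and "frechet_derivative (\<lambda>y. triple_wedge (f y) (g y) (h y) [b, c, d]) (at x) a
     - frechet_derivative (\<lambda>y. triple_wedge (f y) (g y) (h y) [a, c, d]) (at x) b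
     + frechet_derivative (\<lambda>y. triple_wedge (f y) (g y) (h y) [a, b, d]) (at x) c
     - frechet_derivative (\<lambda>y. triple_wedge (f y) (g y) (h y) [a, b, c]) (at x) d
     = wedge22 (dform1 f x) (wedge11 (g x) (h x)) a b c d - wedge22 (dform1 g x) (wedge11 (f x) (h x)) a b c d
       + wedge22 (dform1 h x) (wedge11 (f x) (g x)) a b c d"
proof -
  note Df = frechet_derivative_works[THEN iffD1, OF f] and Dg = frechet_derivative_works[THEN iffD1, OF g]
    and Dh = frechet_derivative_works[THEN iffD1, OF h]
  let ?D = "\<lambda>f b u. frechet_derivative (\<lambda>y. f y b) (at x) u"
  have e: "triple_wedge f g h [b, c, d] = f b * (g c * h d - g d * h c) - f c * (g b * h d - g d * h b)
      + f d * (g b * h c - g c * h b)" for f g h :: "'v \<Rightarrow> real" and b c d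
    by (simp add: triple_wedge_def)
  have t: "((\<lambda>y. f y b * (g y c * h y d - g y d * h y c)) has_derivative (\<lambda>u.
      f x b * ((g x c * ?D h d u + ?D g c u * h x d) - (g x d * ?D h c u + ?D g d u * h x c))
      + ?D f b u * (g x c * h x d - g x d * h x c))) (at x)" for b c d
    by (intro has_derivative_diff has_derivative_mult Df Dg Dh)
  \<comment> \<open>The three instances of \<open>t\<close> are the terms of the cofactor expansion
    of \<open>triple_wedge\<close>, with b, c and d in turn as the argument of f.\<close>
  note T = has_derivative_add[OF has_derivative_diff[OF t t] t, of b c d c b d d b c for b c d]
  show "(\<lambda>y. triple_wedge (f y) (g y) (h y) [a, b, c]) differentiable (at x)"
    unfolding e differentiable_def using T[of a b c] by blast
  show "frechet_derivative (\<lambda>y. triple_wedge (f y) (g y) (h y) [b, c, d]) (at x) a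
     - frechet_derivative (\<lambda>y. triple_wedge (f y) (g y) (h y) [a, c, d]) (at x) b
     + frechet_derivative (\<lambda>y. triple_wedge (f y) (g y) (h y) [a, b, d]) (at x) c
     - frechet_derivative (\<lambda>y. triple_wedge (f y) (g y) (h y) [a, b, c]) (at x) d
     = wedge22 (dform1 f x) (wedge11 (g x) (h x)) a b c d - wedge22 (dform1 g x) (wedge11 (f x) (h x)) a b c d
       + wedge22 (dform1 h x) (wedge11 (f x) (g x)) a b c d"
    unfolding e T[THEN frechet_derivative_at, symmetric]
    by (simp add: wedge22_def wedge11_def dform1_def algebra_simps)
qed

text \<open>The index type 3 is the ring of integers mod 3. Writing the indices as k, k + 1, k + 2
  replaces the structure constants of su(2) by cyclic addition.\<close>

lemma cyclic_3:
  fixes k :: 3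
  shows "k + 1 + 1 = k + 2" "k + 1 + 2 = k" "k + 2 + 1 = k" "k + 2 + 2 = k + 1"
    "k + 1 \<noteq> k" "k + 2 \<noteq> k" "k + 1 \<noteq> k + 2" "k \<noteq> k + 1" "k \<noteq> k + 2" "k + 2 \<noteq> k + 1"
  using exhaust_3[of k] by auto

lemma cyclic_3_cases:
  fixes j k :: 3
  shows "j = k \<or> j = k + 1 \<or> j = k + 2"
  using exhaust_3[of k] exhaust_3[of j] by auto

lemma wedge22_wedge11_eq_0:
  "wedge22 (wedge11 f g) (wedge11 f h) a b c d = 0"
  "wedge22 (wedge11 g f) (wedge11 f h) a b c d = 0"
  "wedge22 (wedge11 f g) (wedge11 h f) a b c d = 0"
  "wedge22 (wedge11 g f) (wedge11 h f) a b c d = 0"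
  by (simp_all add: wedge22_def wedge11_def algebra_simps)

lemma wedge22_add_left: "wedge22 (\<lambda>a b. p a b + q a b) r a b c d = wedge22 p r a b c d + wedge22 q r a b c d"
  and wedge22_diff_left: "wedge22 (\<lambda>a b. p a b - q a b) r a b c d = wedge22 p r a b c d - wedge22 q r a b c d"
  and wedge22_diff_right: "wedge22 r (\<lambda>a b. p a b - q a b) a b c d = wedge22 r p a b c d - wedge22 r q a b c d"
  by (simp_all add: wedge22_def algebra_simps)

lemma wedge21_diff_left: "wedge21 (\<lambda>a b. p a b - q a b) f a b c = wedge21 p f a b c - wedge21 q f a b c"
  and wedge21_add_left: "wedge21 (\<lambda>a b. p a b + q a b) f a b c = wedge21 p f a b c + wedge21 q f a b c"
  by (simp_all add: wedge21_def algebra_simps)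

lemma wedge21_wedge11_eq_0:
  "wedge21 (wedge11 f g) f a b c = 0" "wedge21 (wedge11 f g) g a b c = 0"
  by (simp_all add: wedge21_def wedge11_def algebra_simps)

lemma wedge21_wedge11_rotate: "wedge21 (wedge11 f g) h a b c = wedge21 (wedge11 g h) f a b c"
  by (simp add: wedge21_def wedge11_def algebra_simps)

lemma wedge21_wedge11_swap: "wedge21 (wedge11 g f) h a b c = - wedge21 (wedge11 f g) h a b c"
  by (simp add: wedge21_def wedge11_def algebra_simps)

text \<open>The second Bianchi identity forces the mixed and the \<open>w\<close>-components of \<open>T\<close> to vanish; the
  remaining components are paired with \<open>w \<and> w\<close> in the closedness condition.\<close>

lemma torsion_eq_0_on_frame:
  fixes T :: "3 \<Rightarrow> 'v \<Rightarrow> 'v \<Rightarrow> real" and w e :: "3 \<Rightarrow> 'v \<Rightarrow> real" and X Y :: "3 \<Rightarrow> 'v"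
  assumes dual: "\<And>i j. w i (X j) = (if i = j then 1 else 0)" "\<And>i j. w i (Y j) = 0"
      "\<And>i j. e i (X j) = 0" "\<And>i j. e i (Y j) = (if i = j then 1 else 0)"
    and bianchi: "\<And>k a b c. wedge21 (T (k + 1)) (e (k + 2)) a b c = wedge21 (T (k + 2)) (e (k + 1)) a b c"
    and closed: "\<And>a b c d. (\<Sum>k\<in>UNIV. wedge22 (T k)
        (\<lambda>a b. wedge11 (w (k + 1)) (w (k + 2)) a b - wedge11 (e (k + 1)) (e (k + 2)) a b) a b c d) = 0"
  shows "T k (X i) (X j) = 0" "T k (X i) (Y j) = 0" "T k (Y i) (Y j) = 0"
proof -
  \<comment> \<open>For index k + 2 the Bianchi identity reads T_k \<and> e_(k+1) = T_(k+1) \<and>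
    e_k; the argument Y_(k+1) selects the coefficient of e_(k+1).\<close>
  show XX: "T k (X i) (X j) = 0" for i j k
    using bianchi[of "k + 2" "X i" "X j" "Y (k + 1)"] by (simp add: wedge21_def dual cyclic_3)
  show XY: "T k (X i) (Y j) = 0" for i j k
  proof -
    have 1: "T n (X i) (Y (n + 1)) = 0" for n
      using bianchi[of "n + 1" "X i" "Y (n + 1)" "Y (n + 2)"] by (simp add: wedge21_def dual cyclic_3)
    have 2: "T n (X i) (Y (n + 2)) = 0" for n
      using bianchi[of "n + 2" "X i" "Y (n + 2)" "Y (n + 1)"] by (simp add: wedge21_def dual cyclic_3)
    have 3: "T (n + 1) (X i) (Y (n + 1)) = - T (n + 2) (X i) (Y (n + 2))" for n
      using bianchi[of n "X i" "Y (n + 1)" "Y (n + 2)"] by (simp add: wedge21_def dual cyclic_3)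
    \<comment> \<open>By fact 3 the diagonal entries change sign at each cyclic step, and the cycle
      has odd length three.\<close>
    have "T k (X i) (Y k) = 0"
      using 3[of k] 3[of "k + 1"] 3[of "k + 2"] by (simp add: cyclic_3)
    then show ?thesis using cyclic_3_cases[of j k] 1 2 by auto
  qed
  show "T k (Y i) (Y j) = 0"
  proof -
    have u: "(UNIV :: 3 set) = {k, k + 1, k + 2}" using cyclic_3_cases[of _ k] by blast
    \<comment> \<open>On mixed pairs w \<and> w - e \<and> e vanishes, on pairs of X's T vanishes,
      and on (X_(k+1), X_(k+2)) only the summand of index k has a nonzero second factor.\<close>
    show ?thesis
      using closed[of "Y i" "Y j" "X (k + 1)" "X (k + 2)"]
      unfolding u by (simp add: wedge22_def wedge11_def dual XX XY cyclic_3)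
  qed
qed

section \<open>The equation dW + W \<and> W = E \<and> E in components, and its consequences\<close>

locale local_frame =
  fixes S :: "'v::euclidean_space set" and w e :: "3 \<Rightarrow> 'v \<Rightarrow> 'v \<Rightarrow> real"
  assumes open_S: "open S"
    and smooth_w: "smooth_on_open S (\<lambda>y. w k y u)" and smooth_e: "smooth_on_open S (\<lambda>y. e k y u)"
    and linear_w: "y \<in> S \<Longrightarrow> linear (w k y)" and linear_e: "y \<in> S \<Longrightarrow> linear (e k y)"
    and structure_eq: "y \<in> S \<Longrightarrow> dform1 (w k) y a b
      = wedge11 (e (k + 1) y) (e (k + 2) y) a b - wedge11 (w (k + 1) y) (w (k + 2) y) a b"
begin

definition torsion :: "3 \<Rightarrow> 'v \<Rightarrow> 'v \<Rightarrow> 'v \<Rightarrow> real" where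
  "torsion k x a b = dform1 (e k) x a b
     + wedge11 (w (k + 1) x) (e (k + 2) x) a b - wedge11 (w (k + 2) x) (e (k + 1) x) a b"

lemma dform1_w: "y \<in> S \<Longrightarrow> dform1 (w k) y
    = (\<lambda>a b. wedge11 (e (k + 1) y) (e (k + 2) y) a b - wedge11 (w (k + 1) y) (w (k + 2) y) a b)"
  by (simp add: fun_eq_iff structure_eq)

lemma dform1_e: "dform1 (e k) x
    = (\<lambda>a b. torsion k x a b - wedge11 (w (k + 1) x) (e (k + 2) x) a b + wedge11 (w (k + 2) x) (e (k + 1) x) a b)"
  by (simp add: fun_eq_iff torsion_def)

lemma differentiable_w: "x \<in> S \<Longrightarrow> (\<lambda>y. w k y u) differentiable (at x)"
  and differentiable_e: "x \<in> S \<Longrightarrow> (\<lambda>y. e k y u) differentiable (at x)"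
  using smooth_on_openD(1) smooth_w smooth_e by blast+

lemma dform1_w_closed:
  assumes x: "x \<in> S"
  shows "frechet_derivative (\<lambda>y. dform1 (w k) y b c) (at x) a
     - frechet_derivative (\<lambda>y. dform1 (w k) y a c) (at x) b
     + frechet_derivative (\<lambda>y. dform1 (w k) y a b) (at x) c = 0"
proof -
  have d: "(\<lambda>y. frechet_derivative (\<lambda>y. w k y u) (at y) v) differentiable (at x)" for u v
    by (rule smooth_on_openD(1)[OF smooth_on_openD(2)[OF smooth_w x] x])
  have "frechet_derivative (\<lambda>y. dform1 (w k) y b c) (at x) a
     = frechet_derivative (\<lambda>y. frechet_derivative (\<lambda>y. w k y c) (at y) b) (at x) a
     - frechet_derivative (\<lambda>y. frechet_derivative (\<lambda>y. w k y b) (at y) c) (at x) a" for a b c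
    unfolding dform1_def
    by (rule has_derivative_diff[OF d[THEN frechet_derivative_works[THEN iffD1]] d[THEN frechet_derivative_works[THEN iffD1]],
          THEN frechet_derivative_at, symmetric, THEN fun_cong])
  then show ?thesis
    using smooth_on_open_frechet_derivative_commute[OF open_S x smooth_w, of k] by simp
qed

text \<open>This is a component of [T, E] = 0. It arises from d(dw) = 0 by differentiating
  \<open>structure_eq\<close> and eliminating de and dw; the triple products without T either repeat
  a factor or cancel in pairs after rotation.\<close>

lemma bianchi:
  assumes x: "x \<in> S"
  shows "wedge21 (torsion (k + 1) x) (e (k + 2) x) a b c = wedge21 (torsion (k + 2) x) (e (k + 1) x) a b c"
proof -
  let ?E = "\<lambda>b c y. wedge11 (e (k + 1) y) (e (k + 2) y) b c" and ?W = "\<lambda>b c y. wedge11 (w (k + 1) y) (w (k + 2) y) b c"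
  note de = dform_wedge11[where f = "e (k + 1)" and g = "e (k + 2)", OF differentiable_e[OF x] differentiable_e[OF x]]
  note dw = dform_wedge11[where f = "w (k + 1)" and g = "w (k + 2)", OF differentiable_w[OF x] differentiable_w[OF x]]
  have "frechet_derivative (\<lambda>y. dform1 (w k) y b c) (at x) a
      = frechet_derivative (?E b c) (at x) a - frechet_derivative (?W b c) (at x) a" for a b c
  proof -
    have "frechet_derivative (\<lambda>y. dform1 (w k) y b c) (at x)
        = frechet_derivative (\<lambda>y. ?E b c y - ?W b c y) (at x)"
      by (rule frechet_derivative_cong_open[OF open_S x structure_eq])
    also have "\<dots> = (\<lambda>a. frechet_derivative (?E b c) (at x) a - frechet_derivative (?W b c) (at x) a)"
      by (rule has_derivative_diff[OF de(1)[THEN frechet_derivative_works[THEN iffD1]] dw(1)[THEN frechet_derivative_works[THEN iffD1]],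
          THEN frechet_derivative_at, symmetric])
    finally show ?thesis by simp
  qed
  then have "wedge21 (dform1 (e (k + 1)) x) (e (k + 2) x) a b c - wedge21 (dform1 (e (k + 2)) x) (e (k + 1) x) a b c
      - (wedge21 (dform1 (w (k + 1)) x) (w (k + 2) x) a b c - wedge21 (dform1 (w (k + 2)) x) (w (k + 1) x) a b c) = 0"
    using dform1_w_closed[OF x, of k b c a] de(2)[of b c a] dw(2)[of b c a] by simp
  then show ?thesis
    unfolding dform1_e dform1_w[OF x] cyclic_3 wedge21_add_left wedge21_diff_left wedge21_wedge11_eq_0
    using wedge21_wedge11_rotate[of "w (k + 2) x" "e k x" "e (k + 2) x" a b c]
      wedge21_wedge11_rotate[of "w (k + 1) x" "e k x" "e (k + 1) x" a b c]
      wedge21_wedge11_swap[where f = "e k x" and g = "e (k + 2) x" and h = "w (k + 2) x", of a b c]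
    by linarith
qed

text \<open>\<open>1/2 Im (\<theta>\<^sub>1 \<and> \<theta>\<^sub>2 \<and> \<theta>\<^sub>3)\<close> for \<open>\<theta> = w + i e\<close>.\<close>

definition dual_form :: "'v \<Rightarrow> 'v list \<Rightarrow> real" where
  "dual_form y us = 1 / 2 * (triple_wedge (e 1 y) (w 2 y) (w 3 y) us + triple_wedge (w 1 y) (e 2 y) (w 3 y) us
     + triple_wedge (w 1 y) (w 2 y) (e 3 y) us - triple_wedge (e 1 y) (e 2 y) (e 3 y) us)"

text \<open>In complex form: d\<theta>_k = i T_k - \<theta>_(k+1) \<and> \<theta>_(k+2), so the
  derivative of the triple product is i times the sum of T_k \<and> \<theta>_(k+1) \<and>
  \<theta>_(k+2). Its imaginary part contains Re (\<theta>_(k+1) \<and> \<theta>_(k+2)) = w \<and> w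
  - e \<and> e.\<close>

lemma dform_dual_form:
  assumes x: "x \<in> S"
  shows "(\<lambda>y. dual_form y [a, b, c]) differentiable (at x)"
    and "frechet_derivative (\<lambda>y. dual_form y [b, c, d]) (at x) a
     - frechet_derivative (\<lambda>y. dual_form y [a, c, d]) (at x) b
     + frechet_derivative (\<lambda>y. dual_form y [a, b, d]) (at x) c
     - frechet_derivative (\<lambda>y. dual_form y [a, b, c]) (at x) d
     = 1 / 2 * (\<Sum>k\<in>UNIV. wedge22 (torsion k x) (\<lambda>a b. wedge11 (w (k + 1) x) (w (k + 2) x) a b
         - wedge11 (e (k + 1) x) (e (k + 2) x) a b) a b c d)" (is "?L = ?R")
proof -
  note de = differentiable_e[OF x] and dw = differentiable_w[OF x]
  note t1 = dform_triple_wedge[where f = "e 1" and g = "w 2" and h = "w 3", OF de dw dw]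
  note t2 = dform_triple_wedge[where f = "w 1" and g = "e 2" and h = "w 3", OF dw de dw]
  note t3 = dform_triple_wedge[where f = "w 1" and g = "w 2" and h = "e 3", OF dw dw de]
  note t4 = dform_triple_wedge[where f = "e 1" and g = "e 2" and h = "e 3", OF de de de]
  note W = frechet_derivative_works[THEN iffD1]
  have D: "((\<lambda>y. dual_form y [a, b, c]) has_derivative (\<lambda>u. 1 / 2 * (
      frechet_derivative (\<lambda>y. triple_wedge (e 1 y) (w 2 y) (w 3 y) [a, b, c]) (at x) u
    + frechet_derivative (\<lambda>y. triple_wedge (w 1 y) (e 2 y) (w 3 y) [a, b, c]) (at x) u
    + frechet_derivative (\<lambda>y. triple_wedge (w 1 y) (w 2 y) (e 3 y) [a, b, c]) (at x) u
    - frechet_derivative (\<lambda>y. triple_wedge (e 1 y) (e 2 y) (e 3 y) [a, b, c]) (at x) u))) (at x)" for a b c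
    unfolding dual_form_def
    by (intro has_derivative_mult_right has_derivative_add has_derivative_diff
        W[OF t1(1)] W[OF t2(1)] W[OF t3(1)] W[OF t4(1)])
  show "(\<lambda>y. dual_form y [a, b, c]) differentiable (at x)"
    using D unfolding differentiable_def by blast
  have c: "(1::3) + 1 = 2" "(1::3) + 2 = 3" "(2::3) + 1 = 3" "(2::3) + 2 = 1" "(3::3) + 1 = 1" "(3::3) + 2 = 2"
    by simp_all
  have "?L = 1 / 2 * (
      (wedge22 (dform1 (e 1) x) (wedge11 (w 2 x) (w 3 x)) a b c d - wedge22 (dform1 (w 2) x) (wedge11 (e 1 x) (w 3 x)) a b c d
       + wedge22 (dform1 (w 3) x) (wedge11 (e 1 x) (w 2 x)) a b c d)
    + (wedge22 (dform1 (w 1) x) (wedge11 (e 2 x) (w 3 x)) a b c d - wedge22 (dform1 (e 2) x) (wedge11 (w 1 x) (w 3 x)) a b c d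
       + wedge22 (dform1 (w 3) x) (wedge11 (w 1 x) (e 2 x)) a b c d)
    + (wedge22 (dform1 (w 1) x) (wedge11 (w 2 x) (e 3 x)) a b c d - wedge22 (dform1 (w 2) x) (wedge11 (w 1 x) (e 3 x)) a b c d
       + wedge22 (dform1 (e 3) x) (wedge11 (w 1 x) (w 2 x)) a b c d)
    - (wedge22 (dform1 (e 1) x) (wedge11 (e 2 x) (e 3 x)) a b c d - wedge22 (dform1 (e 2) x) (wedge11 (e 1 x) (e 3 x)) a b c d
       + wedge22 (dform1 (e 3) x) (wedge11 (e 1 x) (e 2 x)) a b c d))"
    unfolding D[THEN frechet_derivative_at, symmetric] t1(2)[symmetric] t2(2)[symmetric] t3(2)[symmetric] t4(2)[symmetric]
    by (simp add: algebra_simps)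
  also have "\<dots> = ?R"
    unfolding sum_3 dform1_e dform1_w[OF x] c wedge22_add_left wedge22_diff_left wedge22_diff_right wedge22_wedge11_eq_0
    by (simp add: wedge22_def wedge11_def algebra_simps)
  finally show "?L = ?R" .
qed

end

section \<open>Forms with values in su(2)\<close>

lemma su2_coord_entries:
  "su2_coord 1 X = - Im (X $ 1 $ 2) - Im (X $ 2 $ 1)"
  "su2_coord 2 X = Re (X $ 2 $ 1) - Re (X $ 1 $ 2)"
  "su2_coord 3 X = Im (X $ 2 $ 2) - Im (X $ 1 $ 1)"
  by (simp_all add: su2_coord_def trace_def matrix_matrix_mult_def sum_2 tau_def pauli_def vector_2)

lemma bounded_linear_su2_coord: "bounded_linear (su2_coord k)"
  unfolding linear_conv_bounded_linear[symmetric] linear_iff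
  using exhaust_3[of k] by (auto simp: su2_coord_entries algebra_simps)

lemmas su2_coord_linear = bounded_linear.linear[OF bounded_linear_su2_coord]
lemmas su2_coord_simps = linear_add[OF su2_coord_linear] linear_diff[OF su2_coord_linear]
  linear_scale[OF su2_coord_linear] linear_0[OF su2_coord_linear]

lemma su2_entries:
  assumes "X \<in> su2"
  shows "X $ 1 $ 1 = Complex 0 (- su2_coord 3 X / 2)" "X $ 2 $ 2 = Complex 0 (su2_coord 3 X / 2)"
    "X $ 1 $ 2 = Complex (- su2_coord 2 X / 2) (- su2_coord 1 X / 2)"
    "X $ 2 $ 1 = Complex (su2_coord 2 X / 2) (- su2_coord 1 X / 2)"
proof -
  have "X $ i $ j = (\<Sum>k\<in>UNIV. su2_coord k X *\<^sub>R tau k) $ i $ j" for i j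
    using su2_coord_expansion[OF assms] by metis
  then show "X $ 1 $ 1 = Complex 0 (- su2_coord 3 X / 2)" "X $ 2 $ 2 = Complex 0 (su2_coord 3 X / 2)"
    "X $ 1 $ 2 = Complex (- su2_coord 2 X / 2) (- su2_coord 1 X / 2)"
    "X $ 2 $ 1 = Complex (su2_coord 2 X / 2) (- su2_coord 1 X / 2)"
    by (simp_all add: sum_3 tau_def pauli_def vector_2 complex_eq_iff)
qed

lemma su2_eq_0_iff:
  assumes "X \<in> su2"
  shows "X = 0 \<longleftrightarrow> (\<forall>k. su2_coord k X = 0)"
proof
  show "\<forall>k. su2_coord k X = 0 \<Longrightarrow> X = 0" using su2_coord_expansion[OF assms] by simp
qed (simp add: su2_coord_simps)

lemma subspace_su2: "subspace su2"
proof -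
  have d: "dagger (A + B) = dagger A + dagger B" "dagger (r *\<^sub>R A) = r *\<^sub>R dagger A" "dagger 0 = 0" for A B and r :: real
    by (simp_all add: dagger_def vec_eq_iff)
  have t: "trace (r *\<^sub>R A) = r *\<^sub>R trace A" for A :: cmat and r :: real
    by (simp add: trace_def scaleR_sum_right)
  show ?thesis
    unfolding subspace_def su2_def by (simp add: d t trace_add) (simp add: trace_def)
qed

text \<open>Products of elements of su(2) leave su(2), but W \<and> W and W \<and> E + E \<and> W
  take their values in sums of commutators.\<close>

lemma su2_commutator:
  assumes "X \<in> su2" "Y \<in> su2"
  shows "X ** Y - Y ** X \<in> su2"
proof -
  have d: "dagger (A - B) = dagger A - dagger B" "dagger (A ** B) = dagger B ** dagger A" for A B
    by (simp_all add: dagger_def vec_eq_iff matrix_matrix_mult_def mult.commute)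
  have m: "(- A) ** (- B) = A ** B" for A B :: cmat
    by (simp add: vec_eq_iff matrix_matrix_mult_def)
  show ?thesis
    using assms by (simp add: su2_def d m trace_sub trace_mul_sym[of X Y])
qed

lemma su2_coord_commutator:
  assumes "X \<in> su2" "Y \<in> su2"
  shows "su2_coord k (X ** Y - Y ** X)
    = su2_coord (k + 1) X * su2_coord (k + 2) Y - su2_coord (k + 2) X * su2_coord (k + 1) Y"
proof -
  have "su2_coord 1 (X ** Y - Y ** X) = su2_coord 2 X * su2_coord 3 Y - su2_coord 3 X * su2_coord 2 Y"
    "su2_coord 2 (X ** Y - Y ** X) = su2_coord 3 X * su2_coord 1 Y - su2_coord 1 X * su2_coord 3 Y"
    "su2_coord 3 (X ** Y - Y ** X) = su2_coord 1 X * su2_coord 2 Y - su2_coord 2 X * su2_coord 1 Y"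
    unfolding su2_coord_entries(1)[of "_ - _"] su2_coord_entries(2)[of "_ - _"] su2_coord_entries(3)[of "_ - _"]
    by (simp_all add: matrix_matrix_mult_def sum_2 su2_entries[OF assms(1)] su2_entries[OF assms(2)] field_simps)
  moreover have c: "(4::3) = 1" "(5::3) = 2" by simp_all
  ultimately show ?thesis using exhaust_3[of k] by (auto simp: c)
qed

lemma Re_trace_su2:
  assumes "X \<in> su2" "Y \<in> su2"
  shows "Re (trace (X ** Y)) = - 1 / 2 * (\<Sum>k\<in>UNIV. su2_coord k X * su2_coord k Y)"
  by (simp add: trace_def matrix_matrix_mult_def sum_2 sum_3 su2_entries[OF assms(1)] su2_entries[OF assms(2)] field_simps)

section \<open>Wedge products and derivatives of matrix-valued forms\<close>

lemma wedge_1_1: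
  "wedge mul 1 1 \<alpha> \<beta> [a, b] = mul (\<alpha> [a]) (\<beta> [b]) - mul (\<alpha> [b]) (\<beta> [a])"
proof -
  have "{\<sigma>. \<sigma> permutes {..<1 + 1::nat}} = {id, Transposition.transpose 0 1}"
    using permutes_doubleton_iff[of _ 0 "1::nat"] by (auto simp: lessThan_Suc insert_commute)
  moreover have "id \<noteq> Transposition.transpose 0 (1::nat)"
    by (metis id_apply transpose_apply_first zero_neq_one)
  ultimately show ?thesis
    unfolding wedge_def by (simp add: sign_swap_id Transposition.transpose_def)
qed

lemma wedge_1_2:
  "wedge mul 1 2 \<alpha> \<beta> [a, b, c] = (1 / 2) *\<^sub>R (
     mul (\<alpha> [a]) (\<beta> [b, c]) - mul (\<alpha> [a]) (\<beta> [c, b]) - mul (\<alpha> [b]) (\<beta> [a, c])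
   + mul (\<alpha> [b]) (\<beta> [c, a]) + mul (\<alpha> [c]) (\<beta> [a, b]) - mul (\<alpha> [c]) (\<beta> [b, a]))"
proof -
  have S: "{..<1 + 2::nat} = insert 0 (insert 1 {2})" by auto
  have f: "finite {1, 2::nat}" "0 \<notin> {1, 2::nat}" "finite {2::nat}" "1 \<notin> {2::nat}" by auto
  have u: "[1..<1 + 2] = [1, 2::nat]" by (simp add: upt_rec)
  show ?thesis
    unfolding wedge_def S u sum_over_permutations_insert[OF f(1,2)] sum_over_permutations_insert[OF f(3,4)] permutes_sing
    by (simp add: sign_compose permutation_swap_id permutation_compose sign_swap_id)
qed

lemma ext_d_1: "ext_d 1 \<omega> c x [a, b]
    = frechet_derivative (\<lambda>y. \<omega> c y [b]) (at x) a - frechet_derivative (\<lambda>y. \<omega> c y [a]) (at x) b"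
  by (simp add: ext_d_def)

lemma ext_d_3: "ext_d 3 \<omega> c x [a, b, d, e]
    = frechet_derivative (\<lambda>y. \<omega> c y [b, d, e]) (at x) a - frechet_derivative (\<lambda>y. \<omega> c y [a, d, e]) (at x) b
    + frechet_derivative (\<lambda>y. \<omega> c y [a, b, e]) (at x) d - frechet_derivative (\<lambda>y. \<omega> c y [a, b, d]) (at x) e"
  by (simp add: ext_d_def eval_nat_numeral)

text \<open>On su(2) the linear map \<open>P\<close> vanishes, so P \<circ> f is zero near x and its
  derivative is P of the derivative of f. A matrix killed by \<open>P\<close> is a real combination
  of the basis of su(2).\<close>

lemma frechet_derivative_su2:
  assumes "open S" "x \<in> S" "f differentiable (at x)" "\<And>y. y \<in> S \<Longrightarrow> f y \<in> su2"
  shows "frechet_derivative f (at x) u \<in> su2"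
proof -
  define P where "P = (\<lambda>X. X - (\<Sum>k\<in>UNIV. su2_coord k X *\<^sub>R tau k))"
  have P: "bounded_linear P"
    unfolding P_def
    by (intro bounded_linear_sub bounded_linear_ident bounded_linear_sum bounded_linear_scaleR_const bounded_linear_su2_coord)
  have tau: "tau k \<in> su2" for k
    using exhaust_3[of k]
    by (auto simp: su2_def tau_def pauli_def dagger_def trace_def vec_eq_iff sum_2 forall_2 vector_2 complex_eq_iff)
  have "P (frechet_derivative f (at x) u) = frechet_derivative (\<lambda>y. P (f y)) (at x) u"
    using frechet_derivative_bounded_linear[OF P assms(3)] by simp
  also have "frechet_derivative (\<lambda>y. P (f y)) (at x) = frechet_derivative (\<lambda>y. 0) (at x)"
    by (rule frechet_derivative_cong_open[OF assms(1,2)])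
      (use su2_coord_expansion[OF assms(4)] in \<open>simp add: P_def\<close>)
  finally have "frechet_derivative f (at x) u = (\<Sum>k\<in>UNIV. su2_coord k (frechet_derivative f (at x) u) *\<^sub>R tau k)"
    by (simp add: P_def frechet_derivative_const)
  moreover have "(\<Sum>k\<in>UNIV. su2_coord k (frechet_derivative f (at x) u) *\<^sub>R tau k) \<in> su2"
    by (intro subspace_sum[OF subspace_su2] subspace_mul[OF subspace_su2] tau)
  ultimately show ?thesis by simp
qed

text \<open>The order of the coordinates makes
  \<open>z\<^sub>k = u\<^sub>k + i u\<^sub>k\<^sub>+\<^sub>3\<close> pull back to \<theta>_k = w_k +
  i e_k, as \<open>model_form\<close> and \<open>model_J\<close> require.\<close>

definition frame_map :: "(3 \<Rightarrow> 'v \<Rightarrow> real) \<Rightarrow> (3 \<Rightarrow> 'v \<Rightarrow> real) \<Rightarrow> 'v \<Rightarrow> real ^ 6" where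
  "frame_map w e u = (\<chi> i. if i = 1 then w 1 u else if i = 2 then w 2 u else if i = 3 then w 3 u
     else if i = 4 then e 1 u else if i = 5 then e 2 u else e 3 u)"

lemma frame_map_nth [simp]:
  "frame_map w e u $ 1 = w 1 u" "frame_map w e u $ 2 = w 2 u" "frame_map w e u $ 3 = w 3 u"
  "frame_map w e u $ 4 = e 1 u" "frame_map w e u $ 5 = e 2 u" "frame_map w e u $ 6 = e 3 u"
  by (simp_all add: frame_map_def)

lemma linear_frame_map:
  assumes "\<And>k. linear (w k)" "\<And>k. linear (e k)"
  shows "linear (frame_map w e)"
  using assms unfolding linear_iff by (simp add: vec_eq_iff forall_6)

lemma model_J_nth [simp]:
  "model_J z $ 1 = - z $ 4" "model_J z $ 2 = - z $ 5" "model_J z $ 3 = - z $ 6"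
  "model_J z $ 4 = z $ 1" "model_J z $ 5 = z $ 2" "model_J z $ 6 = z $ 3"
  by (simp_all add: model_J_def)

text \<open>X and Y are the images of the coordinate axes under the inverse of the coframe
  map.\<close>

lemma dual_frame:
  assumes lin: "linear (frame_map w e)" and det: "det (matrix (frame_map w e)) \<noteq> 0"
  obtains X Y :: "3 \<Rightarrow> real ^ 6"
  where "\<And>i j. w i (X j) = (if i = j then 1 else 0)" "\<And>i j. w i (Y j) = 0"
    "\<And>i j. e i (X j) = 0" "\<And>i j. e i (Y j) = (if i = j then 1 else 0)"
    "\<And>u. u = (\<Sum>k\<in>UNIV. w k u *\<^sub>R X k) + (\<Sum>k\<in>UNIV. e k u *\<^sub>R Y k)"
proof -
  let ?A = "frame_map w e"
  have inj: "inj ?A" using det_nz_iff_inj[OF lin] det by simp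
  then have "surj ?A" using linear_injective_imp_surjective[OF lin] by simp
  define B where "B = inv ?A"
  have AB: "?A (B z) = z" for z unfolding B_def by (simp add: \<open>surj ?A\<close> surj_f_inv_f)
  have linB: "linear B" unfolding B_def using inj_linear_imp_inv_linear[OF lin inj] .
  have n: "z $ 1 = w 1 (B z)" "z $ 2 = w 2 (B z)" "z $ 3 = w 3 (B z)"
    "z $ 4 = e 1 (B z)" "z $ 5 = e 2 (B z)" "z $ 6 = e 3 (B z)" for z
    using AB[of z] frame_map_nth[of w e "B z"] by simp_all
  define X where "X = (\<lambda>j::3. B (axis (if j = 1 then 1 else if j = 2 then 2 else 3) 1))"
  define Y where "Y = (\<lambda>j::3. B (axis (if j = 1 then 4 else if j = 2 then 5 else 6) 1))"
  have ax: "axis i 1 $ j = (if i = j then 1 else (0::real))" for i j :: 6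
    by (simp add: axis_def)
  have "\<forall>i j. w i (X j) = (if i = j then 1 else 0) \<and> w i (Y j) = 0 \<and> e i (X j) = 0
      \<and> e i (Y j) = (if i = j then 1 else 0)"
    unfolding forall_3 X_def Y_def by (simp add: n[symmetric] ax)
  moreover have "u = (\<Sum>k\<in>UNIV. w k u *\<^sub>R X k) + (\<Sum>k\<in>UNIV. e k u *\<^sub>R Y k)" for u
  proof -
    have "u = B (?A u)" unfolding B_def using inj by simp
    also have "\<dots> = B (\<Sum>i\<in>UNIV. ?A u $ i *\<^sub>R axis i 1)"
      using vec_6_expansion[of "?A u"] by simp
    also have "\<dots> = (\<Sum>k\<in>UNIV. w k u *\<^sub>R X k) + (\<Sum>k\<in>UNIV. e k u *\<^sub>R Y k)"
      by (simp add: linear_add[OF linB] linear_scale[OF linB] sum_6 sum_3 X_def Y_def)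
    finally show ?thesis .
  qed
  ultimately show thesis using that by blast
qed

locale local_frame_6 = local_frame S w e for S :: "(real ^ 6) set" and w e
begin

lemma torsion_antisym: "torsion k x b a = - torsion k x a b"
  by (simp add: torsion_def dform1_def wedge11_def)

text \<open>Linearity of e in its vector argument holds on all of the open set S, so it survives
  differentiation with respect to the base point.\<close>

lemma linear_torsion:
  assumes x: "x \<in> S"
  shows "linear (\<lambda>b. torsion k x a b)"
proof -
  have lf: "linear (\<lambda>b. frechet_derivative (\<lambda>y. e k y b) (at x) a)"
  proof (rule linearI)
    fix b c r
    have "frechet_derivative (\<lambda>y. e k y (b + c)) (at x) = frechet_derivative (\<lambda>y. e k y b + e k y c) (at x)"
      by (rule frechet_derivative_cong_open[OF open_S x]) (simp add: linear_add[OF linear_e])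
    also have "\<dots> = (\<lambda>u. frechet_derivative (\<lambda>y. e k y b) (at x) u + frechet_derivative (\<lambda>y. e k y c) (at x) u)"
      by (rule has_derivative_add[OF differentiable_e[OF x, THEN frechet_derivative_works[THEN iffD1]]
            differentiable_e[OF x, THEN frechet_derivative_works[THEN iffD1]], THEN frechet_derivative_at, symmetric])
    finally show "frechet_derivative (\<lambda>y. e k y (b + c)) (at x) a
        = frechet_derivative (\<lambda>y. e k y b) (at x) a + frechet_derivative (\<lambda>y. e k y c) (at x) a" by simp
    have "frechet_derivative (\<lambda>y. e k y (r *\<^sub>R b)) (at x) = frechet_derivative (\<lambda>y. r *\<^sub>R e k y b) (at x)"
      by (rule frechet_derivative_cong_open[OF open_S x]) (simp add: linear_scale[OF linear_e])
    then show "frechet_derivative (\<lambda>y. e k y (r *\<^sub>R b)) (at x) a = r *\<^sub>R frechet_derivative (\<lambda>y. e k y b) (at x) a"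
      using frechet_derivative_bounded_linear[OF bounded_linear_scaleR_right differentiable_e[OF x]] by simp
  qed
  have lu: "linear (\<lambda>b. frechet_derivative (\<lambda>y. e k y a) (at x) b)"
    by (rule linear_frechet_derivative[OF differentiable_e[OF x]])
  have lw: "linear (\<lambda>b. wedge11 f g a b)" if "linear f" "linear g" for f g :: "real ^ 6 \<Rightarrow> real"
    using that unfolding wedge11_def linear_iff by (simp add: algebra_simps)
  show ?thesis
    unfolding torsion_def dform1_def
    by (intro linear_compose_add linear_compose_sub lf lu lw linear_w[OF x] linear_e[OF x])
qed

text \<open>\<open>torsion_eq_0_on_frame\<close> gives vanishing on pairs from the dual frame;
  linearity in the second argument and antisymmetry extend it to all vectors.\<close>

lemma torsion_eq_0_iff:
  assumes x: "x \<in> S" and det: "det (matrix (frame_map (\<lambda>k. w k x) (\<lambda>k. e k x))) \<noteq> 0"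
  shows "(\<forall>a b c d. (\<Sum>k\<in>UNIV. wedge22 (torsion k x) (\<lambda>a b. wedge11 (w (k + 1) x) (w (k + 2) x) a b
         - wedge11 (e (k + 1) x) (e (k + 2) x) a b) a b c d) = 0)
    \<longleftrightarrow> (\<forall>k a b. torsion k x a b = 0)"
proof
  assume closed: "\<forall>a b c d. (\<Sum>k\<in>UNIV. wedge22 (torsion k x) (\<lambda>a b. wedge11 (w (k + 1) x) (w (k + 2) x) a b
         - wedge11 (e (k + 1) x) (e (k + 2) x) a b) a b c d) = 0"
  have lin: "linear (frame_map (\<lambda>k. w k x) (\<lambda>k. e k x))"
    by (rule linear_frame_map) (rule linear_w[OF x] linear_e[OF x])+
  obtain X Y where dual: "\<And>i j. w i x (X j) = (if i = j then 1 else 0)" "\<And>i j. w i x (Y j) = 0"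
      "\<And>i j. e i x (X j) = 0" "\<And>i j. e i x (Y j) = (if i = j then 1 else 0)"
    and ex: "\<And>u. u = (\<Sum>k\<in>UNIV. w k x u *\<^sub>R X k) + (\<Sum>k\<in>UNIV. e k x u *\<^sub>R Y k)"
    by (rule dual_frame[OF lin det]) blast
  note T0 = torsion_eq_0_on_frame[where T = "\<lambda>k. torsion k x" and w = "\<lambda>k. w k x" and e = "\<lambda>k. e k x",
      OF dual bianchi[OF x] closed[rule_format]]
  note l = linear_torsion[OF x]
  have expand: "torsion k x a b = (\<Sum>i\<in>UNIV. w i x b * torsion k x a (X i)) + (\<Sum>i\<in>UNIV. e i x b * torsion k x a (Y i))" for k a b
    by (subst ex[of b]) (simp add: linear_add[OF l] linear_sum[OF l] linear_scale[OF l])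
  have YX: "torsion k x (Y i) (X j) = 0" for k i j
    using torsion_antisym[of k x "X j" "Y i"] T0(2) by simp
  have X0: "torsion k x (X i) b = 0" and Y0: "torsion k x (Y i) b = 0" for k i b
    using expand[of k "X i" b] expand[of k "Y i" b] T0 YX by simp_all
  have X1: "torsion k x a (X i) = 0" and Y1: "torsion k x a (Y i) = 0" for k i a
    using torsion_antisym[of k x a] X0 Y0 by simp_all
  show "\<forall>k a b. torsion k x a b = 0"
    using expand X1 Y1 by simp
qed (simp add: wedge22_def)

text \<open>Multiplying all three arguments by i multiplies \<theta>_1 \<and> \<theta>_2 \<and>
  \<theta>_3 by i^3 = -i, and Re (-i z) = Im z.\<close>

lemma dual_form_eq_model_form:
  "length us = 3 \<Longrightarrow> model_form (map (\<lambda>u. model_J (frame_map (\<lambda>k. w k y) (\<lambda>k. e k y) u)) us) = dual_form y us"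
  by (auto simp: numeral_3_eq_3 length_Suc_conv model_form_def dual_form_def triple_wedge_def algebra_simps)

lemma continuous_on_det_frame_map:
  "continuous_on S (\<lambda>y. det (matrix (frame_map (\<lambda>k. w k y) (\<lambda>k. e k y))))"
proof -
  have "\<forall>i. continuous_on S (\<lambda>y. frame_map (\<lambda>k. w k y) (\<lambda>k. e k y) u $ i)" for u
    unfolding forall_6 by (simp add: smooth_on_open_continuous_on smooth_w smooth_e)
  then show ?thesis
    unfolding det_def matrix_def by (intro continuous_on_sum continuous_on_mult continuous_on_const continuous_on_prod) simp
qed

end

section \<open>Coefficient forms in one chart\<close>

locale su2_one_form =
  fixes AP :: "('p::topological_space, 6) chart set" and c :: "('p, 6) chart" and \<omega> :: "('p, 6, cmat) form_field"
  assumes atlas: "smooth_atlas AP" and c: "c \<in> AP"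
    and smooth: "smooth_form AP 1 \<omega>" and su2: "su2_valued AP 1 \<omega>"
begin

definition coeff :: "3 \<Rightarrow> real ^ 6 \<Rightarrow> real ^ 6 \<Rightarrow> real" where
  "coeff k y u = su2_coord k (\<omega> c y [u])"

lemma open_chart_img: "open (chart_img c)"
  using atlas c unfolding smooth_atlas_def is_chart_def by blast

lemma value_in_su2: "y \<in> chart_img c \<Longrightarrow> \<omega> c y [u] \<in> su2"
  using su2 c unfolding su2_valued_def by simp

lemma smooth_value: "smooth_on_open (chart_img c) (\<lambda>y. \<omega> c y [u])"
  using smooth c unfolding smooth_form_def by simp

lemma smooth_coeff: "smooth_on_open (chart_img c) (\<lambda>y. coeff k y u)"
  unfolding coeff_def by (rule smooth_on_open_bounded_linear[OF open_chart_img bounded_linear_su2_coord smooth_value])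

lemma linear_coeff:
  assumes "y \<in> chart_img c"
  shows "linear (coeff k y)"
proof -
  have "linear (\<lambda>u. \<omega> c y [u])"
    using alternating_multilinearD(1)[of 1 "\<omega> c y" "[0]" 0] smooth c assms unfolding smooth_form_def by simp
  from linear_compose[OF this su2_coord_linear[of k]] show ?thesis
    by (simp add: coeff_def[abs_def] o_def)
qed

lemma ext_d_coeff:
  assumes x: "x \<in> chart_img c"
  shows "ext_d 1 \<omega> c x [a, b] \<in> su2" and "su2_coord k (ext_d 1 \<omega> c x [a, b]) = dform1 (coeff k) x a b"
proof -
  note d = smooth_on_openD(1)[OF smooth_value x]
  show "ext_d 1 \<omega> c x [a, b] \<in> su2"
    unfolding ext_d_1 by (intro subspace_diff[OF subspace_su2] frechet_derivative_su2[OF open_chart_img x d value_in_su2])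
  show "su2_coord k (ext_d 1 \<omega> c x [a, b]) = dform1 (coeff k) x a b"
    unfolding ext_d_1 dform1_def coeff_def su2_coord_simps
    by (simp only: frechet_derivative_bounded_linear[OF bounded_linear_su2_coord d])
qed

lemma wedge_self_coeff:
  assumes x: "x \<in> chart_img c"
  shows "mat_wedge 1 1 \<omega> \<omega> c x [a, b] \<in> su2"
    and "su2_coord k (mat_wedge 1 1 \<omega> \<omega> c x [a, b]) = wedge11 (coeff (k + 1) x) (coeff (k + 2) x) a b"
  unfolding wedge_1_1 wedge11_def coeff_def
  using su2_commutator[OF value_in_su2[OF x] value_in_su2[OF x]]
    su2_coord_commutator[OF value_in_su2[OF x] value_in_su2[OF x], of k a b] by simp_all

end

locale connection_and_frame = W: su2_one_form AP c W + E: su2_one_form AP c E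
  for AP :: "('p::topological_space, 6) chart set" and c W E +
  assumes curvature_eq: "form_eq AP 2 (curvature W) (mat_wedge 1 1 E E)"
begin

lemma ext_d_W:
  assumes "x \<in> chart_img c"
  shows "ext_d 1 W c x [a, b] = mat_wedge 1 1 E E c x [a, b] - mat_wedge 1 1 W W c x [a, b]"
  using curvature_eq W.c assms unfolding form_eq_def curvature_def by (simp add: eq_diff_eq)

sublocale local_frame_6 "chart_img c" W.coeff E.coeff
proof
  fix y k a b assume y: "y \<in> chart_img c"
  show "dform1 (W.coeff k) y a b = wedge11 (E.coeff (k + 1) y) (E.coeff (k + 2) y) a b
      - wedge11 (W.coeff (k + 1) y) (W.coeff (k + 2) y) a b"
    using ext_d_W[OF y, of a b] W.ext_d_coeff(2)[OF y, of k a b]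
    by (simp only: su2_coord_simps W.wedge_self_coeff(2)[OF y] E.wedge_self_coeff(2)[OF y])
qed (simp_all add: W.open_chart_img W.smooth_coeff E.smooth_coeff
    linear_add[OF W.linear_coeff] linear_add[OF E.linear_coeff] linear_scale[OF W.linear_coeff] linear_scale[OF E.linear_coeff])

abbreviation frame_at :: "real ^ 6 \<Rightarrow> real ^ 6 \<Rightarrow> real ^ 6" where
  "frame_at y \<equiv> frame_map (\<lambda>k. W.coeff k y) (\<lambda>k. E.coeff k y)"

lemma linear_frame_at: "y \<in> chart_img c \<Longrightarrow> linear (frame_at y)"
  by (intro linear_frame_map W.linear_coeff E.linear_coeff)

text \<open>The trace form on su(2) is -1/2 times the scalar product of coordinates. Substituting
  dw_k, the product w_1 \<and> w_2 \<and> w_3 receives 3/2 from W \<and> dW and -1 from the cubic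
  term, hence 1/2, and each w_k \<and> e_(k+1) \<and> e_(k+2) receives -1/2.\<close>

lemma chern_simons_eq:
  assumes x: "x \<in> chart_img c" and us: "length us = 3"
  shows "chern_simons W c x us = model_form (map (frame_at x) us)"
proof -
  obtain a b d where us: "us = [a, b, d]" using us by (auto simp: numeral_3_eq_3 length_Suc_conv)
  have tr: "trace (r *\<^sub>R A) = r *\<^sub>R trace A" for A :: cmat and r :: real
    by (simp add: trace_def scaleR_sum_right)
  note RW = Re_trace_su2[OF W.value_in_su2[OF x] W.ext_d_coeff(1)[OF x]]
    and RS = Re_trace_su2[OF W.value_in_su2[OF x] W.wedge_self_coeff(1)[OF x]]
  have c: "(1::3) + 1 = 2" "(1::3) + 2 = 3" "(2::3) + 1 = 3" "(2::3) + 2 = 1" "(3::3) + 1 = 1" "(3::3) + 2 = 2"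
    by simp_all
  show ?thesis
    unfolding us chern_simons_def wedge_1_2 trace_add trace_sub tr scaleR_complex.sel minus_complex.sel plus_complex.sel
      RW RS W.ext_d_coeff(2)[OF x] W.wedge_self_coeff(2)[OF x] structure_eq[OF x] W.coeff_def[symmetric] sum_3 c
    by (simp add: wedge11_def model_form_def triple_wedge_def field_simps)
qed

lemma pulled_back: "x \<in> chart_img c \<Longrightarrow> pulled_back_form (frame_at x) (chern_simons W c x)"
  by (simp add: pulled_back_form_def linear_frame_at chern_simons_eq)

lemma cov_d_coeff:
  assumes x: "x \<in> chart_img c"
  shows "cov_d W E c x [a, b] = 0 \<longleftrightarrow> (\<forall>k. torsion k x a b = 0)"
proof -
  note W = W.value_in_su2[OF x] and E = E.value_in_su2[OF x]
  have eq: "cov_d W E c x [a, b] = ext_d 1 E c x [a, b]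
      + (W c x [a] ** E c x [b] - E c x [b] ** W c x [a]) - (W c x [b] ** E c x [a] - E c x [a] ** W c x [b])"
    unfolding cov_d_def wedge_1_1 by simp
  have "cov_d W E c x [a, b] \<in> su2"
    unfolding eq by (intro subspace_add[OF subspace_su2] subspace_diff[OF subspace_su2] su2_commutator W E E.ext_d_coeff(1)[OF x])
  moreover have "su2_coord k (cov_d W E c x [a, b]) = torsion k x a b" for k
  proof -
    have "su2_coord k (A + B - C) = su2_coord k A + su2_coord k B - su2_coord k C" for A B C
      by (simp add: su2_coord_simps)
    then show ?thesis
      unfolding eq by (simp add: su2_coord_commutator[OF W E] E.ext_d_coeff(2)[OF x] torsion_def wedge11_def
        W.coeff_def E.coeff_def del: One_nat_def)
  qed
  ultimately show ?thesis using su2_eq_0_iff by simp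
qed

text \<open>With v positive, the sign relating the dual form of the Chern-Simons form to
  \<open>dual_form\<close> is that of the coframe determinant. Near x it is a nonzero constant s, so
  \<open>ext_d\<close> sees \<open>dual_form\<close> up to the factor -s.\<close>

lemma hat_form_closed_iff:
  assumes x: "x \<in> chart_img c"
    and v: "\<And>y. y \<in> chart_img c \<Longrightarrow> v c y std_frame > 0"
    and neg: "\<And>y. y \<in> chart_img c \<Longrightarrow> hitchin_lambda (v c y) (chern_simons W c y) < 0"
  shows "(\<forall>us. length us = 4 \<longrightarrow> ext_d 3 (\<lambda>c x. hat_form (v c x) (chern_simons W c x)) c x us = 0)
    \<longleftrightarrow> (\<forall>k a b. torsion k x a b = 0)"
proof -
  let ?hat = "\<lambda>c x. hat_form (v c x) (chern_simons W c x)"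
  let ?det = "\<lambda>y. det (matrix (frame_at y))"
  have det: "?det y \<noteq> 0" and hat: "length us = 3 \<Longrightarrow> ?hat c y us = - sgn (?det y) * dual_form y us"
    if y: "y \<in> chart_img c" for y us
  proof -
    interpret pulled_back_form "frame_at y" "chern_simons W c y" by (rule pulled_back[OF y])
    have v0: "v c y std_frame \<noteq> 0" using v[OF y] by simp
    show "?det y \<noteq> 0" using hat_form_eq(1)[OF v0 neg[OF y], of "[0, 0, 0]"] by simp
    assume us: "length us = 3"
    show "?hat c y us = - sgn (?det y) * dual_form y us"
      unfolding hat_form_eq(2)[OF v0 neg[OF y] us] dual_form_eq_model_form[OF us]
      using v[OF y] by (simp add: sgn_divide)
  qed
  define s where "s = sgn (?det x)"
  have s: "s \<noteq> 0" using det[OF x] by (simp add: s_def sgn_zero_iff)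
  \<comment> \<open>The neighbourhood of x on which the determinant keeps the sign it has at x; it
    is open by continuity.\<close>
  define U where "U = chart_img c \<inter> (\<lambda>y. s * ?det y) -` {0<..}"
  have "open U"
    unfolding U_def
    by (intro continuous_open_preimage continuous_on_mult continuous_on_const continuous_on_det_frame_map
        W.open_chart_img open_greaterThan)
  have "x \<in> U" using x det[OF x] by (simp add: U_def s_def sgn_if)
  have "sgn (?det y) = s" if "y \<in> U" for y
    using that s by (auto simp: U_def s_def sgn_if zero_less_mult_iff split: if_splits)
  then have hatU: "?hat c y us = (- s) * dual_form y us" if "y \<in> U" "length us = 3" for y us
    using hat[of y us] that by (simp add: U_def)
  have fd: "frechet_derivative (\<lambda>y. ?hat c y [a, b, d]) (at x) u = (- s) * frechet_derivative (\<lambda>y. dual_form y [a, b, d]) (at x) u"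
    for a b d u
  proof -
    have "frechet_derivative (\<lambda>y. ?hat c y [a, b, d]) (at x) = frechet_derivative (\<lambda>y. (- s) * dual_form y [a, b, d]) (at x)"
      by (rule frechet_derivative_cong_open[OF \<open>open U\<close> \<open>x \<in> U\<close>]) (simp add: hatU)
    then show ?thesis
      using frechet_derivative_bounded_linear[OF bounded_linear_mult_right dform_dual_form(1)[OF x], of "- s"] by simp
  qed
  let ?B = "\<lambda>a b d e. \<Sum>k\<in>UNIV. wedge22 (torsion k x) (\<lambda>a b. wedge11 (W.coeff (k + 1) x) (W.coeff (k + 2) x) a b
         - wedge11 (E.coeff (k + 1) x) (E.coeff (k + 2) x) a b) a b d e"
  have "ext_d 3 ?hat c x [a, b, d, e] = - s / 2 * ?B a b d e" for a b d e
    using arg_cong[OF dform_dual_form(2)[OF x, of b d e a], of "\<lambda>r. (- s) * r"]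
    unfolding ext_d_3 fd by (simp add: algebra_simps)
  then have "ext_d 3 ?hat c x [a, b, d, e] = 0 \<longleftrightarrow> ?B a b d e = 0" for a b d e
    using s by simp
  then have "(\<forall>us. length us = 4 \<longrightarrow> ext_d 3 ?hat c x us = 0) \<longleftrightarrow> (\<forall>a b d e. ?B a b d e = 0)"
    by (auto simp: eval_nat_numeral length_Suc_conv)
  then show ?thesis using torsion_eq_0_iff[OF x det[OF x]] by simp
qed

end

theorem proposition2:
  fixes AM :: "('m::{t2_space, second_countable_topology}, 3) chart set"
    and AP :: "('p::{t2_space, second_countable_topology}, 6) chart set"
    and proj :: "'p \<Rightarrow> 'm"
    and act :: "'p \<Rightarrow> cmat \<Rightarrow> 'p"
    and v :: "('p, 6, real) form_field"
    and W E :: "('p, 6, cmat) form_field"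
  assumes "oriented_atlas AM"
    and "oriented_atlas AP"
    and "principal_SU2_bundle AM AP proj act"
    and "positive_volume_form AP v"
    and "connection_form AP act W"
    and "stable_negative AP v (chern_simons W)"
    and "frame_form AM AP proj act E"
    and "orientation_compatible AM AP proj E"
    and "form_eq AP 2 (curvature W) (mat_wedge 1 1 E E)"
  shows "form_eq AP 4 (ext_d 3 (\<lambda>c x. hat_form (v c x) (chern_simons W c x))) (\<lambda>c x us. 0)
     \<longleftrightarrow> form_eq AP 2 (cov_d W E) (\<lambda>c x us. 0)"
proof -
  \<comment> \<open>The equivalence holds at every point of every chart separately; only its
    derivation at a point uses the equations in a neighbourhood.\<close>
  have "(\<forall>us. length us = 4 \<longrightarrow> ext_d 3 (\<lambda>c x. hat_form (v c x) (chern_simons W c x)) c x us = 0)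
      \<longleftrightarrow> (\<forall>us. length us = 2 \<longrightarrow> cov_d W E c x us = 0)"
    if c: "c \<in> AP" and x: "x \<in> chart_img c" for c x
  proof -
    interpret connection_and_frame AP c W E
      using assms c
      by unfold_locales (auto simp: oriented_atlas_def connection_form_def frame_form_def)
    have "(\<forall>us. length us = 2 \<longrightarrow> cov_d W E c x us = 0) \<longleftrightarrow> (\<forall>k a b. torsion k x a b = 0)"
      using cov_d_coeff[OF x] by (auto simp: eval_nat_numeral length_Suc_conv)
    moreover have "\<And>y. y \<in> chart_img c \<Longrightarrow> v c y std_frame > 0"
      using assms(4) c by (simp add: positive_volume_form_def)
    moreover have "\<And>y. y \<in> chart_img c \<Longrightarrow> hitchin_lambda (v c y) (chern_simons W c y) < 0"
      using assms(6) c by (simp add: stable_negative_def)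
    ultimately show ?thesis using hat_form_closed_iff[OF x] by blast
  qed
  then show ?thesis unfolding form_eq_def by blast
qed

end
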